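(* Work in the setting described in the context, with $h=1/n$ ($n$ a positive integer, the number of particles) and initial position $(s,y)$, $s\in[0,T]$, $y\in\Sigma_d^h$. Assume that $\sigma:\Sigma_d\to\mathbb{R}$ is Lipschitz continuous with a constant $R$, and that the function $\varphi$ is a supersolution of the Hamilton--Jacobi equation with terminal condition given by $\sigma$. If the first player uses the control with guide strategy $\hat{\mathfrak{u}}$ determined by (u1)--(u3) for the function $\varphi$, then (i) $$\lim_{\delta\downarrow 0}\sup\bigl\{\mathbb{E}_{sy}^h\bigl(\sigma(\mathcal{X}_1^h[T,s,y,\hat{\mathfrak{u}},\Delta,v])\bigr):\ d(\Delta)\le\delta,\ v\in\mathcal{V}^h[s]\bigr\}\le\varphi(s,y)+R\sqrt{Dh};$$ (ii) $$\lim_{\delta\downarrow 0}\sup\bigl\{P_{sy}^h\bigl(\sigma(\mathcal{X}_1^h[T,s,y,\hat{\mathfrak{u}},\Delta,v])\ge\varphi(s,y)+R\sqrt[3]{Dh}\bigr):\ d(\Delta)\le\delta,\ v\in\mathcal{V}^h[s]\bigr\}\le\sqrt[3]{Dh}.$$ Here $D$ is a constant not dependent on $\varphi$ and $\sigma$.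
   Context: **Data.** $T>0$, $\Sigma_d=\{x=(x_1,\dots,x_d):x_i\ge0,\ x_1+\dots+x_d=1\}$ (row vectors, Euclidean inner product $\langle\cdot,\cdot\rangle$). $U,V$ are compact sets (control sets of the first and second player). $Q(t,x,u,v)=(Q_{ij}(t,x,u,v))_{i,j=1}^d$, for $t\in[0,T]$, $x\in\Sigma_d$, $u\in U$, $v\in V$, is a Kolmogorov matrix: $Q_{ij}\ge0$ for $i\ne j$ and $Q_{ii}=-\sum_{j\ne i}Q_{ij}$. Assumptions: $Q$ is continuous in its variables; for any $t,u,v$ the function $x\mapsto Q(t,x,u,v)$ is Lipschitz continuous; and for all $t\in[0,T]$, $\xi\in\mathbb{R}^d$, $x\in\Sigma_d$, $$\min_{u\in U}\max_{v\in V}\langle\xi,xQ(t,x,u,v)\rangle=\max_{v\in V}\min_{u\in U}\langle\xi,xQ(t,x,u,v)\rangle.$$ Put $H(t,x,\xi)=\min_{u\in U}\max_{v\in V}\langle\xi,xQ(t,x,u,v)\rangle$. **Markov game.** Let $\Sigma_d^h=\{x\in\Sigma_d:x_i\in h\mathbb{Z}\}$ and, for $f:\Sigma_d^h\to\mathbb{R}$, $$L_t^h[u,v]f(x)=\sum_{i,j=1}^d\frac1h x_iQ_{ij}(t,x,u,v)\,[f(x-he^i+he^j)-f(x)],$$ where $e^i$ is the $i$-th coordinate vector. Let $(\Omega,\mathcal{F},\{\mathcal{F}_t\},P)$ be a filtered probability space. A pair of stochastic processes $(u,v)$ on $[s,T]$ is an admissible pair of controls if: $u(t)\in U$, $v(t)\in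 V$; $u,v$ are progressively measurable; and for any $y\in\Sigma_d^h$ there exists a unique $\{\mathcal{F}_t\}_{t\in[s,T]}$-adapted càdlàg process $X^h(t,s,y,u,v)$ with values in $\Sigma_d^h$, starting at $y$ at time $s$ and satisfying $$\mathbb{E}_{sy}^hf(X^h(t,s,y,u,v))-f(y)=\int_s^t\mathbb{E}_{sy}^h\,L_\tau^h[u(\tau),v(\tau)]f(X^h(\tau,s,y,u,v))\,d\tau,$$ where $\mathbb{E}_{sy}^h$ denotes the conditional expectation under the condition that the process with parameter $h$ starts at $y$ at time $s$; $P_{sy}^h(A)=\mathbb{E}_{sy}^h\mathbf{1}_A$. $\mathcal{U}_{\rm det}[s]$ is the set of measurable functions $[s,T]\to U$. $\mathcal{V}^h[s]$ is the set of $V$-valued stochastic processes $v$ such that $(u,v)$ is admissible for any $u\in\mathcal{U}_{\rm det}[s]$. **Control with guide strategies.** A control with guide strategy of player 1 is a triple $\mathfrak{u}=(u(t,x,w),\psi_1(t_+,t,x,w),\chi_1(s,y))$: $u(t,x,w)$ is the control implemented after time $t$ if at time $t$ the state is $x$ and the guide's state is $w$; $\psi_1(t_+,t,x,w)$ is the guide's state at time $t_+$ if at time $t$ the state is $x$ and the guide's state is $w$; $\chi_1(s,y)$ is the guide's state at the initial position $(s,y)$. Given a partition $\Delta=\{t_k\}_{k=0}^m$ of $[s,T]$ with mesh $d(\Delta)$, and $v\in\mathcal{V}^h[s]$, the process $\mathcal{X}_1^h[\cdot,s,y,\mathfrak{u},\Delta,v]$ is defined by $\mathcal{X}_1^h[t,s,y,\mathfrak{u},\Delta,v]=X^h(t,t_k,x_k,u_k,v)$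 for $t\in[t_k,t_{k+1})$ (and value $x_m$ at $t=T$), where $x_0=y$, $w_0=\chi_1(t_0,x_0)$, $u_0=u(t_0,x_0,w_0)$, and for $k=1,\dots,m$: $x_k=X^h(t_k,t_{k-1},x_{k-1},u_{k-1},v)$, $w_k=\psi_1(t_k,t_{k-1},x_{k-1},w_{k-1})$, $u_k=u(t_k,x_k,w_k)$. **Supersolution.** The Hamilton--Jacobi equation is $\partial W/\partial t+H(t,x,\nabla W)=0$, $W(T,x)=\sigma(x)$. That $\varphi$ is a supersolution means that $\varphi(T,\cdot)=\sigma$ and for any $(t_*,x_* )\in[0,T]\times\Sigma_d$, $t_+>t_*$ ($t_+\le T$) and $v_*\in V$ there exists a solution $\zeta_1(\cdot,t_+,t_*,x_*,v_* )$ of the differential inclusion $\dot\zeta_1(t)\in\mathrm{co}\{\zeta_1(t)Q(t,\zeta_1(t),u,v_* ):u\in U\}$ with $\zeta_1(t_*,t_+,t_*,x_*,v_* )=x_*$ and $\varphi(t_+,\zeta_1(t_+,t_+,t_*,x_*,v_* ))\le\varphi(t_*,x_* )$. **Strategy $\hat{\mathfrak{u}}=(\hat u,\hat\psi_1,\hat\chi_1)$.** For $t_*,t_+\in[0,T]$, $t_+>t_*$, and $x_*,w_*\in\Sigma_d$ choose $u_*\in U$, $v_*\in V$ with $$\min_{u\in U}\max_{v\in V}\langle x_*-w_*,x_*Q(t_*,x_*,u,v)\rangle=\max_{v\in V}\langle x_*-w_*,x_*Q(t_*,x_*,u_*,v)\rangle,$$ $$\max_{v\in V}\min_{u\in U}\langle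 x_*-w_*,x_*Q(t_*,x_*,u,v)\rangle=\min_{u\in U}\langle x_*-w_*,x_*Q(t_*,x_*,u,v_* )\rangle,$$ and put (u1) $\hat u(t_*,x_*,w_* )=u_*$; (u2) $\hat\psi_1(t_+,t_*,x_*,w_* )=\zeta_1(t_+,t_+,t_*,w_*,v_* )$; (u3) $\hat\chi_1(s,y)=y$.
   Formalization: The Lipschitz constant of Q in x is assumed uniform in t, u, v (with constants depending on t, u, v the bound can fail for small h), and R is assumed positive (for R = 0 claim (ii) fails, e.g. s = T with σ constant). *)

theory Defs
  imports "HOL-Probability.Probability"
begin

text \<open>
  Points of the simplex are row vectors, so the product of a state and a matrix is \<open>v*\<close>.
  The number of coordinates is \<open>CARD('d)\<close>. Processes are functions of time and outcome,
  total on the reals; only their values on the relevant time interval matter.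
\<close>

type_synonym ('u, 'v, 'd) rate_matrix = "real \<Rightarrow> real^'d \<Rightarrow> 'u \<Rightarrow> 'v \<Rightarrow> real^'d^'d"
type_synonym ('w, 'a) process = "real \<Rightarrow> 'w \<Rightarrow> 'a"

definition prob_simplex :: "(real^'d) set" where
  "prob_simplex = {x. (\<forall>i. 0 \<le> x $ i) \<and> (\<Sum>i\<in>UNIV. x $ i) = 1}"

definition grid_simplex :: "real \<Rightarrow> (real^'d) set" where
  "grid_simplex h = {x \<in> prob_simplex. \<forall>i. \<exists>k::int. x $ i = h * of_int k}"

definition kolmogorov :: "real^'d^'d \<Rightarrow> bool" where
  "kolmogorov q \<longleftrightarrow>
     (\<forall>i j. i \<noteq> j \<longrightarrow> 0 \<le> q $ i $ j) \<and> (\<forall>i. q $ i $ i = - (\<Sum>j\<in>UNIV - {i}. q $ i $ j))"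

text \<open>
  In the uses below the payoff is continuous in each control and the control sets are compact
  and nonempty, so the suprema and infima are maxima and minima.
\<close>

definition minmax :: "'u set \<Rightarrow> 'v set \<Rightarrow> ('u \<Rightarrow> 'v \<Rightarrow> real) \<Rightarrow> real" where
  "minmax U V g = (INF u\<in>U. SUP v\<in>V. g u v)"

definition maxmin :: "'u set \<Rightarrow> 'v set \<Rightarrow> ('u \<Rightarrow> 'v \<Rightarrow> real) \<Rightarrow> real" where
  "maxmin U V g = (SUP v\<in>V. INF u\<in>U. g u v)"


subsection \<open>The Markov game\<close>

definition generator ::
  "('u, 'v, 'd::finite) rate_matrix \<Rightarrow> real \<Rightarrow> real \<Rightarrow> 'u \<Rightarrow> 'v \<Rightarrow> (real^'d \<Rightarrow> real) \<Rightarrow> real^'d \<Rightarrow> real"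
where
  "generator Q h t u v f x =
     (\<Sum>i\<in>UNIV. \<Sum>j\<in>UNIV.
        1 / h * x $ i * Q t x u v $ i $ j * (f (x - h *\<^sub>R axis i 1 + h *\<^sub>R axis j 1) - f x))"

definition progressively_measurable ::
  "(real \<Rightarrow> 'w measure) \<Rightarrow> real \<Rightarrow> real \<Rightarrow> ('w, 'a::topological_space) process \<Rightarrow> bool" where
  "progressively_measurable F s T p \<longleftrightarrow>
     (\<forall>t\<in>{s..T}. (\<lambda>(\<tau>, \<omega>). p \<tau> \<omega>) \<in> restrict_space borel {s..t} \<Otimes>\<^sub>M F t \<rightarrow>\<^sub>M borel)"

definition cadlag_on :: "real \<Rightarrow> real \<Rightarrow> (real \<Rightarrow> 'a::topological_space) \<Rightarrow> bool" where
  "cadlag_on s T p \<longleftrightarrow>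
     (\<forall>t\<in>{s..<T}. (p \<longlongrightarrow> p t) (at_right t)) \<and> (\<forall>t\<in>{s<..T}. \<exists>l. (p \<longlongrightarrow> l) (at_left t))"

text \<open>
  The conditional expectation of a motion that starts at a given point at time \<open>s\<close> is the
  conditional expectation given the history up to \<open>s\<close>. It is written through the conditional
  probabilities given the non-null events of \<open>F s\<close>, the whole space being one of them.
  Conditioning is needed since motions are restarted at intermediate times \<open>s\<close>, at points
  which depend on the history.
\<close>

definition cond_probs :: "'w measure \<Rightarrow> 'w measure \<Rightarrow> 'w measure set" where
  "cond_probs M G = {uniform_measure M A | A. A \<in> sets G \<and> 0 < measure M A}"

definition is_motion ::
  "'w measure \<Rightarrow> (real \<Rightarrow> 'w measure) \<Rightarrow> real \<Rightarrow> ('u, 'v, 'd::finite) rate_matrix \<Rightarrow> real \<Rightarrow>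
   real \<Rightarrow> real^'d \<Rightarrow> ('w, 'u) process \<Rightarrow> ('w, 'v) process \<Rightarrow> ('w, real^'d) process \<Rightarrow> bool"
where
  "is_motion M F T Q h s y u v X \<longleftrightarrow>
     (\<forall>t\<in>{s..T}. X t \<in> F t \<rightarrow>\<^sub>M borel) \<and>
     (\<forall>\<omega>\<in>space M. cadlag_on s T (\<lambda>t. X t \<omega>)) \<and>
     (\<forall>t\<in>{s..T}. \<forall>\<omega>\<in>space M. X t \<omega> \<in> grid_simplex h) \<and>
     (\<forall>\<omega>\<in>space M. X s \<omega> = y) \<and>
     (\<forall>P\<in>cond_probs M (F s). \<forall>t\<in>{s..T}. \<forall>f.
        (\<integral>\<omega>. f (X t \<omega>) \<partial>P) - f y =
        (LINT \<tau>:{s..t}|lborel. \<integral>\<omega>. generator Q h \<tau> (u \<tau> \<omega>) (v \<tau> \<omega>) f (X \<tau> \<omega>) \<partial>P))"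

text \<open>Uniqueness of the motion is up to indistinguishability.\<close>

definition admissible ::
  "'w measure \<Rightarrow> (real \<Rightarrow> 'w measure) \<Rightarrow> real \<Rightarrow> 'u::topological_space set \<Rightarrow> 'v::topological_space set \<Rightarrow>
   ('u, 'v, 'd::finite) rate_matrix \<Rightarrow> real \<Rightarrow> real \<Rightarrow> ('w, 'u) process \<Rightarrow> ('w, 'v) process \<Rightarrow> bool"
where
  "admissible M F T U V Q h s u v \<longleftrightarrow>
     (\<forall>t\<in>{s..T}. \<forall>\<omega>\<in>space M. u t \<omega> \<in> U \<and> v t \<omega> \<in> V) \<and>
     progressively_measurable F s T u \<and> progressively_measurable F s T v \<and>
     (\<forall>y\<in>grid_simplex h.
        (\<exists>X. is_motion M F T Q h s y u v X) \<and>
        (\<forall>X X'. is_motion M F T Q h s y u v X \<longrightarrow> is_motion M F T Q h s y u v X' \<longrightarrow>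
           (AE \<omega> in M. \<forall>t\<in>{s..T}. X t \<omega> = X' t \<omega>)))"

definition motion ::
  "'w measure \<Rightarrow> (real \<Rightarrow> 'w measure) \<Rightarrow> real \<Rightarrow> ('u, 'v, 'd::finite) rate_matrix \<Rightarrow> real \<Rightarrow>
   real \<Rightarrow> real^'d \<Rightarrow> ('w, 'u) process \<Rightarrow> ('w, 'v) process \<Rightarrow> ('w, real^'d) process"
where
  "motion M F T Q h s y u v = (SOME X. is_motion M F T Q h s y u v X)"

definition det_controls :: "real \<Rightarrow> 'u::topological_space set \<Rightarrow> real \<Rightarrow> (real \<Rightarrow> 'u) set" where
  "det_controls T U s =
     {u \<in> restrict_space borel {s..T} \<rightarrow>\<^sub>M borel. \<forall>t\<in>{s..T}. u t \<in> U}"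

definition stoch_controls ::
  "'w measure \<Rightarrow> (real \<Rightarrow> 'w measure) \<Rightarrow> real \<Rightarrow> 'u::topological_space set \<Rightarrow> 'v::topological_space set \<Rightarrow>
   ('u, 'v, 'd::finite) rate_matrix \<Rightarrow> real \<Rightarrow> real \<Rightarrow> ('w, 'v) process set"
where
  "stoch_controls M F T U V Q h s =
     {v. \<forall>u\<in>det_controls T U s. admissible M F T U V Q h s (\<lambda>t \<omega>. u t) v}"


subsection \<open>Control with guide strategies\<close>

record ('u, 'd) guide_strategy =
  control :: "real \<Rightarrow> real^'d \<Rightarrow> real^'d \<Rightarrow> 'u"
  guide :: "real \<Rightarrow> real \<Rightarrow> real^'d \<Rightarrow> real^'d \<Rightarrow> real^'d"
  guide_init :: "real \<Rightarrow> real^'d \<Rightarrow> real^'d"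

definition is_partition :: "real \<Rightarrow> real \<Rightarrow> nat \<Rightarrow> (nat \<Rightarrow> real) \<Rightarrow> bool" where
  "is_partition s T m t \<longleftrightarrow> t 0 = s \<and> t m = T \<and> (\<forall>k<m. t k < t (Suc k))"

text \<open>The element 0 only matters for \<open>s = T\<close>, when \<open>m = 0\<close>.\<close>

definition mesh :: "nat \<Rightarrow> (nat \<Rightarrow> real) \<Rightarrow> real" where
  "mesh m t = Max (insert 0 ((\<lambda>k. t (Suc k) - t k) ` {..<m}))"

text \<open>The pair of the state \<open>x\<^sub>k\<close> and the guide's state \<open>w\<^sub>k\<close> at time \<open>t k\<close>.\<close>

primrec guided_step ::
  "'w measure \<Rightarrow> (real \<Rightarrow> 'w measure) \<Rightarrow> real \<Rightarrow> ('u, 'v, 'd::finite) rate_matrix \<Rightarrow> real \<Rightarrow>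
   real^'d \<Rightarrow> ('u, 'd) guide_strategy \<Rightarrow> (nat \<Rightarrow> real) \<Rightarrow> ('w, 'v) process \<Rightarrow>
   nat \<Rightarrow> 'w \<Rightarrow> (real^'d) \<times> (real^'d)"
where
  "guided_step M F T Q h y S t v 0 = (\<lambda>\<omega>. (y, guide_init S (t 0) y))"
| "guided_step M F T Q h y S t v (Suc k) =
     (\<lambda>\<omega>. let (x, w) = guided_step M F T Q h y S t v k \<omega> in
        (motion M F T Q h (t k) x (\<lambda>_ _. control S (t k) x w) v (t (Suc k)) \<omega>,
         guide S (t (Suc k)) (t k) x w))"

definition guided_motion ::
  "'w measure \<Rightarrow> (real \<Rightarrow> 'w measure) \<Rightarrow> real \<Rightarrow> ('u, 'v, 'd::finite) rate_matrix \<Rightarrow> real \<Rightarrow>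
   real^'d \<Rightarrow> ('u, 'd) guide_strategy \<Rightarrow> nat \<Rightarrow> (nat \<Rightarrow> real) \<Rightarrow> ('w, 'v) process \<Rightarrow>
   ('w, real^'d) process"
where
  "guided_motion M F T Q h y S m t v \<tau> \<omega> =
     (let k = (GREATEST k. k \<le> m \<and> t k \<le> \<tau>);
          (x, w) = guided_step M F T Q h y S t v k \<omega>
      in if k < m then motion M F T Q h (t k) x (\<lambda>_ _. control S (t k) x w) v \<tau> \<omega> else x)"


subsection \<open>Supersolutions and the strategy determined by them\<close>

text \<open>
  The derivative of the absolutely continuous function \<open>z\<close> is \<open>g\<close>. Since \<open>Q\<close> is meaningful
  on the simplex only, \<open>z\<close> is required to stay there.
\<close>

definition solves_inclusion ::
  "'u set \<Rightarrow> ('u, 'v, 'd::finite) rate_matrix \<Rightarrow> 'v \<Rightarrow> real \<Rightarrow> real \<Rightarrow> real^'d \<Rightarrow> (real \<Rightarrow> real^'d) \<Rightarrow> bool"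
where
  "solves_inclusion U Q v a b x z \<longleftrightarrow>
     (\<forall>t\<in>{a..b}. z t \<in> prob_simplex) \<and>
     (\<exists>g. g absolutely_integrable_on {a..b} \<and>
        (\<forall>t\<in>{a..b}. z t = x + integral {a..t} g) \<and>
        (AE t in lborel. t \<in> {a..b} \<longrightarrow> g t \<in> convex hull {z t v* Q t (z t) u v | u. u \<in> U}))"

definition super_witness ::
  "'u set \<Rightarrow> ('u, 'v, 'd::finite) rate_matrix \<Rightarrow> (real \<Rightarrow> real^'d \<Rightarrow> real) \<Rightarrow>
   real \<Rightarrow> real \<Rightarrow> real^'d \<Rightarrow> 'v \<Rightarrow> (real \<Rightarrow> real^'d) \<Rightarrow> bool"
where
  "super_witness U Q \<phi> t' t x v z \<longleftrightarrow>
     solves_inclusion U Q v t t' x z \<and> \<phi> t' (z t') \<le> \<phi> t x"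

definition supersolution ::
  "real \<Rightarrow> 'u set \<Rightarrow> 'v set \<Rightarrow> ('u, 'v, 'd::finite) rate_matrix \<Rightarrow>
   (real^'d \<Rightarrow> real) \<Rightarrow> (real \<Rightarrow> real^'d \<Rightarrow> real) \<Rightarrow> bool"
where
  "supersolution T U V Q \<sigma> \<phi> \<longleftrightarrow>
     (\<forall>x\<in>prob_simplex. \<phi> T x = \<sigma> x) \<and>
     (\<forall>t\<in>{0..T}. \<forall>t'\<in>{t<..T}. \<forall>x\<in>prob_simplex. \<forall>v\<in>V. \<exists>z. super_witness U Q \<phi> t' t x v z)"

text \<open>
  In the following two definitions \<open>\<zeta> \<tau> t' t x v\<close> is the state at time \<open>\<tau>\<close> of the chosen
  solution of the inclusion which starts at \<open>x\<close> at time \<open>t\<close> and is run until \<open>t'\<close>.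
\<close>

definition solution_choice ::
  "real \<Rightarrow> 'u set \<Rightarrow> 'v set \<Rightarrow> ('u, 'v, 'd::finite) rate_matrix \<Rightarrow> (real \<Rightarrow> real^'d \<Rightarrow> real) \<Rightarrow>
   (real \<Rightarrow> real \<Rightarrow> real \<Rightarrow> real^'d \<Rightarrow> 'v \<Rightarrow> real^'d) \<Rightarrow> bool"
where
  "solution_choice T U V Q \<phi> \<zeta> \<longleftrightarrow>
     (\<forall>t\<in>{0..T}. \<forall>t'\<in>{t<..T}. \<forall>x\<in>prob_simplex. \<forall>v\<in>V.
        super_witness U Q \<phi> t' t x v (\<lambda>\<tau>. \<zeta> \<tau> t' t x v))"

definition extremal_strategy ::
  "real \<Rightarrow> 'u set \<Rightarrow> 'v set \<Rightarrow> ('u, 'v, 'd::finite) rate_matrix \<Rightarrow>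
   (real \<Rightarrow> real \<Rightarrow> real \<Rightarrow> real^'d \<Rightarrow> 'v \<Rightarrow> real^'d) \<Rightarrow> ('u, 'd) guide_strategy \<Rightarrow> bool"
where
  "extremal_strategy T U V Q \<zeta> S \<longleftrightarrow>
     (\<forall>t\<in>{0..T}. \<forall>t'\<in>{t<..T}. \<forall>x\<in>prob_simplex. \<forall>w\<in>prob_simplex.
        let g = (\<lambda>u v. (x - w) \<bullet> (x v* Q t x u v)); u\<^sub>0 = control S t x w in
        u\<^sub>0 \<in> U \<and> minmax U V g = (SUP v\<in>V. g u\<^sub>0 v) \<and>
        (\<exists>v\<^sub>0\<in>V. maxmin U V g = (INF u\<in>U. g u v\<^sub>0) \<and> guide S t' t x w = \<zeta> t' t' t w v\<^sub>0)) \<and>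
     (\<forall>s\<in>{0..T}. \<forall>y\<in>prob_simplex. guide_init S s y = y)"

end

theory Submission
  imports Defs
begin

text \<open>
  Along one step of the partition, of length \<open>\<Delta>\<close>, condition on the values \<open>x\<close> of the state and
  \<open>w\<close> of the guide, and let \<open>w'\<close> be the next state of the guide. The generator applied to
  \<open>|\<cdot> - w'|\<^sup>2\<close> equals \<open>2\<langle>\<cdot> - w', xQ\<rangle>\<close> plus a term of order \<open>h\<close>. By the saddle point condition the control of
  the player keeps \<open>\<langle>x - w, xQ\<rangle>\<close> below the value of the local game at \<open>x\<close>, while the guide moves
  with a velocity whose product with \<open>x - w\<close> is at least that value, up to \<open>L|x - w|\<^sup>2\<close>. Hence the
  conditional expectation of \<open>|x\<^sub>k - w\<^sub>k|\<^sup>2\<close> is multiplied by at most \<open>1 + 2L\<Delta>\<close> and increased by at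
  most \<open>(Ch + o(1))\<Delta>\<close>, and the discrete Gronwall argument bounds it by \<open>Dh + o(1)\<close> at time \<open>T\<close>.
  Since \<open>\<phi>\<close> does not increase along the guide, \<open>\<sigma>\<close> at the final state exceeds \<open>\<phi> s y\<close> by at most
  \<open>R|x\<^sub>m - w\<^sub>m|\<close>; the two claims are the Cauchy-Schwarz and the Chebyshev inequality. The remainder
  \<open>o(1)\<close> may depend on \<open>h\<close>, which is fixed while the mesh tends to 0.
\<close>

subsection \<open>The simplex, the drift and the generator\<close>

definition drift :: "('u, 'v, 'd::finite) rate_matrix \<Rightarrow> real \<Rightarrow> real^'d \<Rightarrow> 'u \<Rightarrow> 'v \<Rightarrow> real^'d" where
  "drift Q t x u v = x v* Q t x u v"

lemma prob_simplexD:
  assumes "x \<in> prob_simplex"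
  shows "0 \<le> x $ i" "x $ i \<le> 1" "(\<Sum>i\<in>UNIV. x $ i) = 1" "norm x \<le> 1"
proof -
  show nonneg: "0 \<le> x $ i" for i
    using assms by (simp add: prob_simplex_def)
  show sum: "(\<Sum>i\<in>UNIV. x $ i) = 1"
    using assms by (simp add: prob_simplex_def)
  show "x $ i \<le> 1"
    unfolding sum[symmetric] by (rule member_le_sum) (use nonneg in auto)
  have "norm x \<le> (\<Sum>i\<in>UNIV. \<bar>x $ i\<bar>)"
    by (rule norm_le_l1_cart)
  then show "norm x \<le> 1"
    using nonneg sum by simp
qed

lemma compact_prob_simplex: "compact (prob_simplex :: (real^'d::finite) set)"
proof -
  have "closed {x::real^'d. (\<forall>i. 0 \<le> x $ i) \<and> (\<Sum>i\<in>UNIV. x $ i) = 1}"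
    by (intro closed_Collect_conj closed_Collect_all closed_Collect_le closed_Collect_eq
        continuous_intros)
  moreover have "bounded (prob_simplex :: (real^'d) set)"
    by (rule boundedI[of _ 1]) (rule prob_simplexD)
  ultimately show ?thesis
    by (simp add: compact_eq_bounded_closed prob_simplex_def)
qed

lemma norm_diff_prob_simplex:
  assumes "x \<in> prob_simplex" "w \<in> prob_simplex"
  shows "norm (x - w) \<le> 2"
  using norm_triangle_ineq4[of x w] prob_simplexD(4)[OF assms(1)] prob_simplexD(4)[OF assms(2)]
  by simp

text \<open>Coordinates are multiples of \<open>h\<close> in the unit interval. Finiteness makes
  every real function of the state bounded and measurable along a motion, whatever test function is
  used.\<close>

lemma finite_grid_simplex:
  assumes "0 < h"
  shows "finite (grid_simplex h :: (real^'d::finite) set)"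
proof (rule finite_subset)
  let ?S = "(\<lambda>k::int. h * of_int k) ` {0..\<lceil>1 / h\<rceil>}"
  show "(grid_simplex h :: (real^'d) set) \<subseteq> vec_lambda ` (UNIV \<rightarrow>\<^sub>E ?S)"
  proof
    fix x :: "real^'d" assume "x \<in> grid_simplex h"
    then have x: "x \<in> prob_simplex" and k: "\<And>i. \<exists>k::int. x $ i = h * of_int k"
      by (auto simp: grid_simplex_def)
    have "x $ i \<in> ?S" for i
    proof -
      obtain k :: int where k: "x $ i = h * of_int k" using k by blast
      have "0 \<le> k" "of_int k \<le> 1 / h"
        using prob_simplexD(1,2)[OF x, of i] assms
        by (auto simp: k zero_le_mult_iff field_simps)
      then show ?thesis using k by (auto intro!: image_eqI[of _ _ k]) linarith
    qed
    then show "x \<in> vec_lambda ` (UNIV \<rightarrow>\<^sub>E ?S)"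
      by (intro image_eqI[of _ _ "vec_nth x"]) auto
  qed
  show "finite (vec_lambda ` (UNIV \<rightarrow>\<^sub>E ?S) :: (real^'d) set)"
    by (intro finite_imageI finite_PiE) auto
qed

lemma vector_matrix_mult_eq_sum_rows:
  fixes x :: "real^'n"
  shows "x v* A = (\<Sum>i\<in>UNIV. x $ i *\<^sub>R A $ i)"
  by (simp add: vec_eq_iff vector_matrix_mult_def mult.commute)

lemma norm_vector_matrix_mult_le:
  fixes x :: "real^'n"
  shows "norm (x v* A) \<le> (\<Sum>i\<in>UNIV. \<bar>x $ i\<bar>) * norm A"
proof -
  have "norm (x v* A) \<le> (\<Sum>i\<in>UNIV. norm (x $ i *\<^sub>R A $ i))"
    unfolding vector_matrix_mult_eq_sum_rows by (rule norm_sum)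
  also have "\<dots> \<le> (\<Sum>i\<in>UNIV. \<bar>x $ i\<bar> * norm A)"
    by (intro sum_mono) (auto intro: mult_left_mono Finite_Cartesian_Product.norm_nth_le)
  finally show ?thesis by (simp add: sum_distrib_right)
qed

text \<open>For differences of simplex points, whose coordinates may have either sign; the factor
  \<open>CARD('n)\<close> comes from comparing the sum norm with the Euclidean norm.\<close>

lemma norm_vector_matrix_mult_le':
  fixes x :: "real^'n"
  shows "norm (x v* A) \<le> CARD('n) * norm x * norm A"
proof -
  have "(\<Sum>i\<in>UNIV. \<bar>x $ i\<bar>) \<le> (\<Sum>i\<in>(UNIV::'n set). norm x)"
    by (intro sum_mono component_le_norm_cart)
  then have "(\<Sum>i\<in>UNIV. \<bar>x $ i\<bar>) * norm A \<le> (CARD('n) * norm x) * norm A"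
    by (intro mult_right_mono) auto
  then show ?thesis using norm_vector_matrix_mult_le[of x A] by linarith
qed

lemma norm_simplex_vector_matrix_mult_le:
  assumes "x \<in> prob_simplex"
  shows "norm (x v* A) \<le> norm A"
  using norm_vector_matrix_mult_le[of x A] prob_simplexD[OF assms] by simp

lemma kolmogorov_row_sum:
  assumes "kolmogorov q"
  shows "(\<Sum>j\<in>UNIV. q $ i $ j) = 0"
  using assms by (simp add: kolmogorov_def sum.remove[of UNIV i])

text \<open>A jump changes the squared distance by a linear part of order \<open>h\<close> and a
  quadratic part of order \<open>h\<^sup>2\<close>, and the rate contributes \<open>1 / h\<close>.
  In the linear part the terms with \<open>(x - c) $ i\<close> cancel because the rows of a
  Kolmogorov matrix sum to 0, and the terms with \<open>(x - c) $ j\<close> form the drift.\<close>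

lemma generator_norm_sq:
  assumes "h \<noteq> 0" "kolmogorov (Q t x u v)"
  shows "generator Q h t u v (\<lambda>x. (norm (x - c))\<^sup>2) x =
    2 * ((x - c) \<bullet> drift Q t x u v) +
    h * (\<Sum>i\<in>UNIV. \<Sum>j\<in>UNIV. x $ i * Q t x u v $ i $ j * (norm (axis j 1 - axis i 1 :: real^'d::finite))\<^sup>2)"
proof -
  let ?q = "Q t x u v" and ?e = "\<lambda>i. axis i (1::real) :: real^'d"
  have summand: "1 / h * x $ i * ?q $ i $ j * ((norm (x - h *\<^sub>R ?e i + h *\<^sub>R ?e j - c))\<^sup>2 - (norm (x - c))\<^sup>2) =
      2 * (x $ i * ?q $ i $ j * (x - c) $ j) - 2 * ((x $ i * (x - c) $ i) * ?q $ i $ j)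
      + h * (x $ i * ?q $ i $ j * (norm (?e j - ?e i))\<^sup>2)" for i j
  proof -
    have *: "x - h *\<^sub>R ?e i + h *\<^sub>R ?e j - c = (x - c) + h *\<^sub>R (?e j - ?e i)"
      by (simp add: algebra_simps)
    have sq: "(norm (x - h *\<^sub>R ?e i + h *\<^sub>R ?e j - c))\<^sup>2 - (norm (x - c))\<^sup>2 =
        2 * h * ((x - c) $ j - (x - c) $ i) + h\<^sup>2 * (norm (?e j - ?e i))\<^sup>2"
      unfolding * power2_norm_eq_inner
      by (simp only: inner_add_left inner_add_right inner_scaleR_left inner_scaleR_right
          inner_diff_right[of "x - c"] inner_axis inner_commute[of "?e j - ?e i" "x - c"])
        (simp add: power2_eq_square algebra_simps)
    show ?thesis
      unfolding sq using assms(1) by (simp add: field_simps power2_eq_square)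
  qed
  have "(\<Sum>i\<in>UNIV. \<Sum>j\<in>UNIV. (x $ i * (x - c) $ i) * ?q $ i $ j) = 0"
    by (simp add: sum_distrib_left[symmetric] kolmogorov_row_sum[OF assms(2)])
  moreover have "(\<Sum>i\<in>UNIV. \<Sum>j\<in>UNIV. x $ i * ?q $ i $ j * (x - c) $ j) = (x - c) \<bullet> drift Q t x u v"
    unfolding drift_def inner_vec_def vector_matrix_mult_def
    by (subst sum.swap) (simp add: sum_distrib_left mult_ac)
  ultimately show ?thesis
    unfolding generator_def summand
    by (simp only: sum.distrib sum_subtractf sum_distrib_left[symmetric])
qed

text \<open>The coordinates of \<open>x\<close> are averaging weights over the rows, and each row
  contributes \<open>CARD('d)\<close> terms of size at most \<open>norm A * c\<close>. This serves
  both the second-order term of the squared distance and the crude bound on the generator.\<close>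

lemma sum_mult_entries_le:
  fixes A :: "real^'d::finite^'d" and e :: "'d \<Rightarrow> 'd \<Rightarrow> real"
  assumes x: "x \<in> prob_simplex" and e: "\<And>i j. \<bar>e i j\<bar> \<le> c"
  shows "(\<Sum>i\<in>UNIV. \<Sum>j\<in>UNIV. x $ i * A $ i $ j * e i j) \<le> CARD('d) * norm A * c"
proof -
  have c: "0 \<le> c" using e abs_ge_zero order_trans by blast
  have "x $ i * A $ i $ j * e i j \<le> x $ i * (norm A * c)" for i j
  proof -
    have "\<bar>A $ i $ j\<bar> \<le> norm A"
      using component_le_norm_cart[of "A $ i" j] Finite_Cartesian_Product.norm_nth_le[of A i] by linarith
    then have "\<bar>A $ i $ j * e i j\<bar> \<le> norm A * c"
      unfolding abs_mult using e c by (intro mult_mono) auto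
    then show ?thesis
      using prob_simplexD(1)[OF x, of i] by (auto simp: mult.assoc intro!: mult_left_mono)
  qed
  then have "(\<Sum>i\<in>UNIV. \<Sum>j\<in>UNIV. x $ i * A $ i $ j * e i j) \<le>
      (\<Sum>i\<in>UNIV. \<Sum>j\<in>(UNIV::'d set). x $ i * (norm A * c))"
    by (intro sum_mono)
  also have "\<dots> = CARD('d) * norm A * c"
    using prob_simplexD(3)[OF x] by (simp add: sum_distrib_left[symmetric] sum_distrib_right[symmetric])
  finally show ?thesis .
qed

lemma sum_mult_entries_axis_le:
  fixes A :: "real^'d::finite^'d"
  assumes x: "x \<in> prob_simplex"
  shows "(\<Sum>i\<in>UNIV. \<Sum>j\<in>UNIV. x $ i * A $ i $ j * (norm (axis j 1 - axis i 1 :: real^'d))\<^sup>2)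
    \<le> CARD('d) * norm A * 4"
proof (rule sum_mult_entries_le[OF x])
  fix i j :: 'd
  have "norm (axis j 1 - axis i 1 :: real^'d) \<le> 2"
    using norm_triangle_ineq4[of "axis j 1 :: real^'d" "axis i 1"] by simp
  then have "(norm (axis j 1 - axis i 1 :: real^'d))\<^sup>2 \<le> 2\<^sup>2"
    by (intro power_mono) auto
  then show "\<bar>(norm (axis j 1 - axis i 1 :: real^'d))\<^sup>2\<bar> \<le> 4" by simp
qed

text \<open>The jump rate of order \<open>1 / h\<close> is multiplied by the oscillation of
  \<open>f\<close>. The growth as \<open>h\<close> tends to 0 is harmless, because in
  \<open>motion_step_le\<close> this bound gets multiplied by the square of the step length.\<close>

lemma generator_le:
  fixes Q :: "('u, 'v, 'd::finite) rate_matrix"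
  assumes "0 < h" "x \<in> prob_simplex" "\<And>x x'. \<bar>f x' - f x\<bar> \<le> c"
  shows "generator Q h t u v f x \<le> CARD('d) * norm (Q t x u v) * c / h"
proof -
  have "generator Q h t u v f x = (\<Sum>i\<in>UNIV. \<Sum>j\<in>UNIV. x $ i * Q t x u v $ i $ j *
      (f (x - h *\<^sub>R axis i 1 + h *\<^sub>R axis j 1) - f x)) / h"
    unfolding generator_def sum_divide_distrib by (simp add: field_simps)
  also have "\<dots> \<le> CARD('d) * norm (Q t x u v) * c / h"
    using assms by (intro divide_right_mono sum_mult_entries_le) auto
  finally show ?thesis .
qed

section \<open>Velocities along solutions of the differential inclusion\<close>

text \<open>On the null set where the inclusion fails the derivative is replaced by the velocity of
  some fixed control; no integral changes, and the inclusion then holds at every time of the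
  interval.\<close>

lemma solves_inclusionE:
  assumes "solves_inclusion U Q v a b w z" "a \<le> b" "U \<noteq> {}"
  obtains g where "g integrable_on {a..b}" "\<And>t. t \<in> {a..b} \<Longrightarrow> z t = w + integral {a..t} g"
    "\<And>t. t \<in> {a..b} \<Longrightarrow> g t \<in> convex hull {drift Q t (z t) u v | u. u \<in> U}"
proof -
  have "\<exists>g. g absolutely_integrable_on {a..b} \<and> (\<forall>t\<in>{a..b}. z t = w + integral {a..t} g) \<and>
      (AE t in lborel. t \<in> {a..b} \<longrightarrow> g t \<in> convex hull {drift Q t (z t) u v | u. u \<in> U})"
    using assms(1) unfolding solves_inclusion_def drift_def by (rule conjunct2)
  then obtain g0 where g0: "g0 absolutely_integrable_on {a..b}"
    "\<forall>t\<in>{a..b}. z t = w + integral {a..t} g0"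
    "AE t in lborel. t \<in> {a..b} \<longrightarrow> g0 t \<in> convex hull {drift Q t (z t) u v | u. u \<in> U}"
    by (elim exE conjE)
  obtain N where N0: "\<And>t. t \<in> space lborel - N \<Longrightarrow>
      t \<in> {a..b} \<longrightarrow> g0 t \<in> convex hull {drift Q t (z t) u v | u. u \<in> U}"
    and N: "N \<in> null_sets lborel"
    by (rule AE_E3[OF g0(3)]) (rule that)
  have g0_hull: "g0 t \<in> convex hull {drift Q t (z t) u v | u. u \<in> U}"
    if "t \<in> {a..b}" "t \<notin> N" for t
    using N0[of t] that by simp
  have neg: "negligible N"
    using N by (simp add: negligible_iff_null_sets null_sets_completionI)
  obtain u0 where u0: "u0 \<in> U" using assms(3) by blast
  define g where "g = (\<lambda>t. if t \<in> N then drift Q t (z t) u0 v else g0 t)"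
  have "integral {a..t} g = integral {a..t} g0" for t
    by (rule integral_spike[OF neg]) (auto simp: g_def)
  moreover have "g integrable_on {a..b}"
    by (rule integrable_spike[OF set_lebesgue_integral_eq_integral(1)[OF g0(1)] neg])
      (simp add: g_def)
  moreover have "g t \<in> convex hull {drift Q t (z t) u v | u. u \<in> U}" if "t \<in> {a..b}" for t
  proof (cases "t \<in> N")
    case True
    then show ?thesis using u0 by (simp add: g_def) (blast intro: hull_inc)
  next
    case False
    then show ?thesis using g0_hull[OF that] by (simp add: g_def)
  qed
  ultimately show ?thesis using g0(2) that[of g] by simp
qed

text \<open>A ball is convex, so the bound on the individual velocities passes to their convex hull
  and then to the integral.\<close>

lemma solves_inclusion_norm_le:
  assumes "solves_inclusion U Q v a b w z" "a \<le> b" "U \<noteq> {}" "0 \<le> K"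
    and K: "\<And>t u. t \<in> {a..b} \<Longrightarrow> u \<in> U \<Longrightarrow> norm (drift Q t (z t) u v) \<le> K"
    and t: "t \<in> {a..b}"
  shows "norm (z t - w) \<le> K * (t - a)"
proof -
  obtain g where g: "g integrable_on {a..b}" "\<And>t. t \<in> {a..b} \<Longrightarrow> z t = w + integral {a..t} g"
    "\<And>t. t \<in> {a..b} \<Longrightarrow> g t \<in> convex hull {drift Q t (z t) u v | u. u \<in> U}"
    using solves_inclusionE[OF assms(1-3)] by blast
  have bound: "norm (g t) \<le> K" if "t \<in> {a..b}" for t
  proof -
    have "convex hull {drift Q t (z t) u v | u. u \<in> U} \<subseteq> cball 0 K"
      using K[OF that] by (intro hull_minimal) (auto simp: convex_cball)
    then show ?thesis using g(3)[OF that] by (auto simp: subset_iff)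
  qed
  have "g integrable_on {a..t}"
    using g(1) t by (auto intro: integrable_on_subinterval)
  then have "norm (integral {a..t} g) \<le> K * Henstock_Kurzweil_Integration.content {a..t}"
    using bound t assms(4) by (intro has_integral_bound_real[where S="{}" and f=g]) (auto intro: integrable_integral)
  then show ?thesis using g(2)[OF t] t by simp
qed

text \<open>A half-space is convex, so a lower bound valid for each single control survives the
  mixing of controls in the convex hull.\<close>

lemma solves_inclusion_inner_ge:
  fixes \<xi> :: "real^'d::finite"
  assumes "solves_inclusion U Q v a b w z" "a \<le> b" "U \<noteq> {}"
    and c: "\<And>t u. t \<in> {a..b} \<Longrightarrow> u \<in> U \<Longrightarrow> c \<le> \<xi> \<bullet> drift Q t (z t) u v"
  shows "c * (b - a) \<le> \<xi> \<bullet> (z b - w)"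
proof -
  obtain g where g: "g integrable_on {a..b}" "\<And>t. t \<in> {a..b} \<Longrightarrow> z t = w + integral {a..t} g"
    "\<And>t. t \<in> {a..b} \<Longrightarrow> g t \<in> convex hull {drift Q t (z t) u v | u. u \<in> U}"
    using solves_inclusionE[OF assms(1-3)] by blast
  have bound: "c \<le> \<xi> \<bullet> g t" if "t \<in> {a..b}" for t
  proof -
    have "convex hull {drift Q t (z t) u v | u. u \<in> U} \<subseteq> {y. \<xi> \<bullet> y \<ge> c}"
      using c[OF that] by (intro hull_minimal) (auto simp: convex_halfspace_ge)
    then show ?thesis using g(3)[OF that] by auto
  qed
  have int: "((\<lambda>t. \<xi> \<bullet> g t) has_integral \<xi> \<bullet> (z b - w)) {a..b}"
    using has_integral_linear[OF integrable_integral[OF g(1)] bounded_linear_inner_right, of \<xi>]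
      g(2)[of b] assms(2) by (simp add: o_def)
  have "((\<lambda>t. c) has_integral c * (b - a)) {a..b}"
    using has_integral_const_real[of c a b] assms(2) by (simp add: mult.commute)
  from has_integral_le[OF this int] bound show ?thesis by auto
qed

subsection \<open>The deterministic part of one step\<close>

text \<open>A single positive \<open>K\<close> is both the bound and the Lipschitz constant of
  \<open>Q\<close>. It can be chosen from the data of the game alone, as \<open>theorem1\<close>
  does, which makes the final constant independent of \<open>\<phi>\<close> and
  \<open>\<sigma>\<close>.\<close>

locale markov_game =
  fixes T :: real
    and U :: "'u::{metric_space, second_countable_topology} set"
    and V :: "'v::{metric_space, second_countable_topology} set"
    and Q :: "('u, 'v, 'd::finite) rate_matrix"
    and K :: real
  assumes compact_U: "compact U" and U_nonempty: "U \<noteq> {}"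
    and compact_V: "compact V" and V_nonempty: "V \<noteq> {}"
    and kolmogorov_Q: "\<And>t x u v. t \<in> {0..T} \<Longrightarrow> x \<in> prob_simplex \<Longrightarrow> u \<in> U \<Longrightarrow> v \<in> V \<Longrightarrow>
      kolmogorov (Q t x u v)"
    and continuous_Q: "continuous_on ({0..T} \<times> prob_simplex \<times> U \<times> V) (\<lambda>(t, x, u, v). Q t x u v)"
    and K_pos: "0 < K"
    and norm_Q_le: "\<And>t x u v. t \<in> {0..T} \<Longrightarrow> x \<in> prob_simplex \<Longrightarrow> u \<in> U \<Longrightarrow> v \<in> V \<Longrightarrow>
      norm (Q t x u v) \<le> K"
    and lipschitz_Q: "\<And>t u v. t \<in> {0..T} \<Longrightarrow> u \<in> U \<Longrightarrow> v \<in> V \<Longrightarrow>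
      K-lipschitz_on prob_simplex (\<lambda>x. Q t x u v)"
    and isaacs: "\<And>t x \<xi>. t \<in> {0..T} \<Longrightarrow> x \<in> prob_simplex \<Longrightarrow>
      minmax U V (\<lambda>u v. \<xi> \<bullet> (x v* Q t x u v)) = maxmin U V (\<lambda>u v. \<xi> \<bullet> (x v* Q t x u v))"
begin

text \<open>The Lipschitz constant of the drift in the state: \<open>CARD('d) * K\<close> accounts
  for the row vector, \<open>K\<close> for the matrix.\<close>

definition L :: real where "L = (CARD('d) + 1) * K"

lemma L_pos: "0 < L"
  using K_pos by (simp add: L_def)

lemma norm_drift_le:
  assumes "t \<in> {0..T}" "x \<in> prob_simplex" "u \<in> U" "v \<in> V"
  shows "norm (drift Q t x u v) \<le> K"
  using norm_simplex_vector_matrix_mult_le[OF assms(2)] norm_Q_le[OF assms]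
  unfolding drift_def by (rule order_trans)

lemma abs_inner_drift_le:
  assumes "t \<in> {0..T}" "x \<in> prob_simplex" "u \<in> U" "v \<in> V"
  shows "\<bar>\<xi> \<bullet> drift Q t x u v\<bar> \<le> norm \<xi> * K"
  by (rule order_trans[OF Cauchy_Schwarz_ineq2 mult_left_mono[OF norm_drift_le[OF assms]]]) simp

lemma drift_lipschitz:
  assumes "t \<in> {0..T}" "x \<in> prob_simplex" "w \<in> prob_simplex" "u \<in> U" "v \<in> V"
  shows "norm (drift Q t x u v - drift Q t w u v) \<le> L * norm (x - w)"
proof -
  have "drift Q t x u v - drift Q t w u v =
      (x - w) v* Q t x u v + w v* (Q t x u v - Q t w u v)"
    unfolding drift_def by (simp add: vector_matrix_mult_diff_distrib vector_matrix_mult_diff_rdistrib)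
  also have "norm \<dots> \<le> norm ((x - w) v* Q t x u v) + norm (w v* (Q t x u v - Q t w u v))"
    by (rule norm_triangle_ineq)
  also have "norm ((x - w) v* Q t x u v) \<le> CARD('d) * norm (x - w) * norm (Q t x u v)"
    by (rule norm_vector_matrix_mult_le')
  also have "\<dots> \<le> CARD('d) * norm (x - w) * K"
    by (intro mult_left_mono norm_Q_le assms) simp
  also have "norm (w v* (Q t x u v - Q t w u v)) \<le> norm (Q t x u v - Q t w u v)"
    by (rule norm_simplex_vector_matrix_mult_le[OF assms(3)])
  also have "\<dots> \<le> K * norm (x - w)"
    using lipschitz_on_normD[OF lipschitz_Q[OF assms(1,4,5)] assms(2,3)] .
  finally show ?thesis by (simp add: L_def algebra_simps)
qed

lemma continuous_drift:
  "continuous_on ({0..T} \<times> prob_simplex \<times> U \<times> V) (\<lambda>(t, x, u, v). drift Q t x u v)"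
proof -
  have Q: "continuous_on ({0..T} \<times> prob_simplex \<times> U \<times> V)
      (\<lambda>p. Q (fst p) (fst (snd p)) (fst (snd (snd p))) (snd (snd (snd p))))"
    using continuous_Q by (simp add: case_prod_unfold)
  show ?thesis
    unfolding drift_def vector_matrix_mult_def case_prod_unfold
    by (intro continuous_intros Q continuous_on_vec_lambda)
qed

lemma drift_uniformly_continuous:
  assumes "0 < \<epsilon>"
  obtains \<delta> where "0 < \<delta>"
    "\<And>t t' x x' u v. t \<in> {0..T} \<Longrightarrow> t' \<in> {0..T} \<Longrightarrow> x \<in> prob_simplex \<Longrightarrow> x' \<in> prob_simplex \<Longrightarrow>
      u \<in> U \<Longrightarrow> v \<in> V \<Longrightarrow> \<bar>t - t'\<bar> < \<delta> \<Longrightarrow> norm (x - x') < \<delta> \<Longrightarrow>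
      norm (drift Q t x u v - drift Q t' x' u v) \<le> \<epsilon>"
proof -
  let ?C = "{0..T} \<times> (prob_simplex :: (real^'d) set) \<times> U \<times> V"
  have "compact ?C"
    by (intro compact_Times compact_Icc compact_prob_simplex compact_U compact_V)
  with continuous_drift have "uniformly_continuous_on ?C (\<lambda>(t, x, u, v). drift Q t x u v)"
    by (rule compact_uniformly_continuous)
  from uniformly_continuous_onE[OF this assms]
  obtain \<delta> where \<delta>: "0 < \<delta>" and uc: "\<And>p p'. p \<in> ?C \<Longrightarrow> p' \<in> ?C \<Longrightarrow> dist p' p < \<delta> \<Longrightarrow>
      dist ((\<lambda>(t, x, u, v). drift Q t x u v) p') ((\<lambda>(t, x, u, v). drift Q t x u v) p) < \<epsilon>"
    by metis
  show ?thesis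
  \<comment> \<open>Half of \<open>\<delta>\<close>, since the distance of the tuples is bounded by
    the sum of the distances in time and in state.\<close>
  proof (rule that[of "\<delta> / 2"])
    show "0 < \<delta> / 2" using \<delta> by simp
    fix t t' u v and x x' :: "real^'d"
    assume *: "t \<in> {0..T}" "t' \<in> {0..T}" "x \<in> prob_simplex" "x' \<in> prob_simplex"
      "u \<in> U" "v \<in> V" "\<bar>t - t'\<bar> < \<delta> / 2" "norm (x - x') < \<delta> / 2"
    have "dist (t, x, u, v) (t', x', u, v) \<le> dist t t' + dist x x'"
      using sqrt_sum_squares_le_sum[of "dist t t'" "dist x x'"] by (simp add: dist_Pair_Pair)
    then have "dist (t, x, u, v) (t', x', u, v) < \<delta>"
      using * by (simp add: dist_norm)
    from uc[OF _ _ this] show "norm (drift Q t x u v - drift Q t' x' u v) \<le> \<epsilon>"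
      using * by (simp add: dist_norm)
  qed
qed

text \<open>The saddle point condition gives both local games the same value \<open>m\<close>, and
  this one number separates the players: the chosen control keeps the product at most
  \<open>m\<close> against every \<open>v\<close>, while freezing the opponent at
  \<open>v\<^sub>0\<close> yields at least \<open>m\<close> for every \<open>u\<close>.\<close>

lemma extremal_strategyE:
  assumes S: "extremal_strategy T U V Q \<zeta> S" and \<zeta>: "solution_choice T U V Q \<phi> \<zeta>"
    and a: "a \<in> {0..T}" and b: "b \<in> {a<..T}"
    and x: "x \<in> prob_simplex" and w: "w \<in> prob_simplex"
  obtains v\<^sub>0 z m where "v\<^sub>0 \<in> V" "solves_inclusion U Q v\<^sub>0 a b w z" "\<phi> b (z b) \<le> \<phi> a w"
    "guide S b a x w = z b" "control S a x w \<in> U"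
    "\<And>v. v \<in> V \<Longrightarrow> (x - w) \<bullet> drift Q a x (control S a x w) v \<le> m"
    "\<And>u. u \<in> U \<Longrightarrow> m \<le> (x - w) \<bullet> drift Q a x u v\<^sub>0"
proof -
  define g where "g = (\<lambda>u v. (x - w) \<bullet> drift Q a x u v)"
  have g: "minmax U V g = maxmin U V g"
    using isaacs[OF a x] by (simp add: g_def drift_def)
  have "control S a x w \<in> U \<and> minmax U V g = (SUP v\<in>V. g (control S a x w) v) \<and>
      (\<exists>v\<^sub>0\<in>V. maxmin U V g = (INF u\<in>U. g u v\<^sub>0) \<and> guide S b a x w = \<zeta> b b a w v\<^sub>0)"
    using S a b x w unfolding extremal_strategy_def g_def drift_def Let_def by blast
  then obtain v\<^sub>0 where u: "control S a x w \<in> U" "minmax U V g = (SUP v\<in>V. g (control S a x w) v)"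
    and v: "v\<^sub>0 \<in> V" "maxmin U V g = (INF u\<in>U. g u v\<^sub>0)" "guide S b a x w = \<zeta> b b a w v\<^sub>0"
    by blast
  have bound: "\<bar>g u v\<bar> \<le> norm (x - w) * K" if "u \<in> U" "v \<in> V" for u v
    unfolding g_def by (rule abs_inner_drift_le[OF a x that])
  have witness: "super_witness U Q \<phi> b a w v\<^sub>0 (\<lambda>\<tau>. \<zeta> \<tau> b a w v\<^sub>0)"
    using \<zeta> a b w v(1) unfolding solution_choice_def by blast
  show ?thesis
  proof (rule that[of v\<^sub>0 "\<lambda>\<tau>. \<zeta> \<tau> b a w v\<^sub>0" "minmax U V g"])
    show "solves_inclusion U Q v\<^sub>0 a b w (\<lambda>\<tau>. \<zeta> \<tau> b a w v\<^sub>0)" "\<phi> b (\<zeta> b b a w v\<^sub>0) \<le> \<phi> a w"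
      using witness by (simp_all add: super_witness_def)
    show "(x - w) \<bullet> drift Q a x (control S a x w) v \<le> minmax U V g" if "v \<in> V" for v
    proof -
      \<comment> \<open>The supremum of an unbounded set of reals is unspecified, so boundedness has
        to be shown before it can serve as an upper bound; likewise for the infimum below.\<close>
      have "bdd_above ((\<lambda>v. g (control S a x w) v) ` V)"
        using bound[OF u(1)] by (intro bdd_aboveI2[where M = "norm (x - w) * K"]) (simp add: abs_le_iff)
      from cSUP_upper[OF that this] show ?thesis unfolding u(2) by (simp add: g_def)
    qed
    show "minmax U V g \<le> (x - w) \<bullet> drift Q a x u v\<^sub>0" if "u \<in> U" for u
    proof -
      have "bdd_below ((\<lambda>u. g u v\<^sub>0) ` U)"
        using bound[OF _ v(1)] by (intro bdd_belowI2[where m = "- (norm (x - w) * K)"]) (simp add: abs_le_iff minus_le_iff)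
      from cINF_lower[OF this that] show ?thesis unfolding g v(2) by (simp add: g_def)
    qed
  qed (use u v in simp_all)
qed

text \<open>The squared distance is expanded at \<open>w\<close>; its cross term is governed by the
  integral of the guide's velocity against \<open>x - w\<close>. Comparing that velocity with the
  drift at \<open>(a, x)\<close> costs \<open>2 * \<epsilon>\<close> for the passage of time and the
  movement of the guide, and \<open>L * (norm (x - w))\<^sup>2\<close> for exchanging the states
  \<open>w\<close> and \<open>x\<close>.\<close>

lemma guide_step_le:
  assumes a: "a \<in> {0..T}" and b: "b \<in> {a<..T}" and x: "x \<in> prob_simplex" and w: "w \<in> prob_simplex"
    and v: "v\<^sub>0 \<in> V" and z: "solves_inclusion U Q v\<^sub>0 a b w z"
    and m: "\<And>u. u \<in> U \<Longrightarrow> m \<le> (x - w) \<bullet> drift Q a x u v\<^sub>0"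
    and uc: "\<And>t y y' u v. t \<in> {a..b} \<Longrightarrow> y \<in> prob_simplex \<Longrightarrow> y' \<in> prob_simplex \<Longrightarrow> u \<in> U \<Longrightarrow>
      v \<in> V \<Longrightarrow> norm (y - y') \<le> K * (b - a) \<Longrightarrow> norm (drift Q t y u v - drift Q a y' u v) \<le> \<epsilon>"
  shows "norm (z b - w) \<le> K * (b - a)"
    and "(norm (x - z b))\<^sup>2 \<le> (norm (x - w))\<^sup>2 - 2 * (b - a) * (m - L * (norm (x - w))\<^sup>2 - 2 * \<epsilon>)
      + (K * (b - a))\<^sup>2"
proof -
  have ab: "a \<le> b" and sub: "t \<in> {a..b} \<Longrightarrow> t \<in> {0..T}" for t
    using a b by auto
  have zS: "z t \<in> prob_simplex" if "t \<in> {a..b}" for t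
    using z that unfolding solves_inclusion_def by blast
  have zw: "norm (z t - w) \<le> K * (t - a)" if "t \<in> {a..b}" for t
    using norm_drift_le[OF sub zS _ v] that K_pos
    by (intro solves_inclusion_norm_le[OF z ab U_nonempty]) auto
  then show zb: "norm (z b - w) \<le> K * (b - a)" using ab by simp
  have \<epsilon>: "0 \<le> \<epsilon>"
  proof -
    obtain u where "u \<in> U" using U_nonempty by blast
    then have "norm (drift Q a x u v\<^sub>0 - drift Q a x u v\<^sub>0) \<le> \<epsilon>"
      using ab x v K_pos by (intro uc) auto
    then show ?thesis by simp
  qed
  let ?\<xi> = "x - w"
  have "(m - L * (norm ?\<xi>)\<^sup>2 - 2 * \<epsilon>) * (b - a) \<le> ?\<xi> \<bullet> (z b - w)"
  proof (rule solves_inclusion_inner_ge[OF z ab U_nonempty])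
    fix t u assume t: "t \<in> {a..b}" and u: "u \<in> U"
    have "norm (z t - w) \<le> K * (b - a)"
      using t K_pos by (intro order_trans[OF zw[OF t]] mult_left_mono) auto
    then have "norm (drift Q t (z t) u v\<^sub>0 - drift Q a w u v\<^sub>0) \<le> \<epsilon>"
      by (intro uc t zS w u v)
    \<comment> \<open>The factor 2 bounds \<open>norm (x - w)\<close>, both points being in the
      simplex.\<close>
    then have "norm ?\<xi> * norm (drift Q t (z t) u v\<^sub>0 - drift Q a w u v\<^sub>0) \<le> 2 * \<epsilon>"
      by (intro mult_mono norm_diff_prob_simplex x w) auto
    then have 1: "\<bar>?\<xi> \<bullet> (drift Q t (z t) u v\<^sub>0 - drift Q a w u v\<^sub>0)\<bar> \<le> 2 * \<epsilon>"
      by (rule order_trans[OF Cauchy_Schwarz_ineq2])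
    have "norm ?\<xi> * norm (drift Q a x u v\<^sub>0 - drift Q a w u v\<^sub>0) \<le> norm ?\<xi> * (L * norm ?\<xi>)"
      by (intro mult_left_mono drift_lipschitz a x w u v) auto
    then have 2: "\<bar>?\<xi> \<bullet> (drift Q a x u v\<^sub>0 - drift Q a w u v\<^sub>0)\<bar> \<le> L * (norm ?\<xi>)\<^sup>2"
      using Cauchy_Schwarz_ineq2[of ?\<xi> "drift Q a x u v\<^sub>0 - drift Q a w u v\<^sub>0"]
      by (simp add: power2_eq_square mult_ac)
    show "m - L * (norm ?\<xi>)\<^sup>2 - 2 * \<epsilon> \<le> ?\<xi> \<bullet> drift Q t (z t) u v\<^sub>0"
      using 1 2 m[OF u] unfolding inner_diff_right by linarith
  qed
  moreover have "(norm (x - z b))\<^sup>2 = (norm ?\<xi>)\<^sup>2 - 2 * (?\<xi> \<bullet> (z b - w)) + (norm (z b - w))\<^sup>2"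
    unfolding power2_norm_eq_inner by (simp add: inner_diff_left inner_diff_right inner_commute)
  moreover have "(norm (z b - w))\<^sup>2 \<le> (K * (b - a))\<^sup>2"
    using zb by (intro power_mono) auto
  moreover have "2 * (b - a) * (m - L * (norm ?\<xi>)\<^sup>2 - 2 * \<epsilon>) = 2 * ((m - L * (norm ?\<xi>)\<^sup>2 - 2 * \<epsilon>) * (b - a))"
    by (simp only: mult_ac)
  ultimately show "(norm (x - z b))\<^sup>2 \<le> (norm ?\<xi>)\<^sup>2 - 2 * (b - a) * (m - L * (norm ?\<xi>)\<^sup>2 - 2 * \<epsilon>)
      + (K * (b - a))\<^sup>2"
    by linarith
qed

text \<open>While the state is still \<open>x\<close>, the control chosen for \<open>x\<close> and
  \<open>w\<close> keeps the product with \<open>x - w\<close> below \<open>m\<close>; moving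
  \<open>w\<close> to \<open>w'\<close> costs \<open>K\<^sup>2 * (b - a)\<close> and the change of
  time \<open>2 * \<epsilon>\<close>. After a jump that choice gives no information and a crude
  bound is used, to be paid for later by the small probability of a jump.\<close>

lemma generator_sq_step_le:
  assumes h: "0 < h" and a: "a \<in> {0..T}" and b: "b \<in> {a<..T}" and \<tau>: "\<tau> \<in> {a..b}"
    and x: "x \<in> prob_simplex" and w: "w \<in> prob_simplex" and w': "w' \<in> prob_simplex"
    and x': "x' \<in> prob_simplex" and u: "u\<^sub>0 \<in> U" and v: "v \<in> V"
    and ww': "norm (w' - w) \<le> K * (b - a)"
    and m: "(x - w) \<bullet> drift Q a x u\<^sub>0 v \<le> m" "- 2 * K \<le> m"
    and uc: "\<And>t y y' u v. t \<in> {a..b} \<Longrightarrow> y \<in> prob_simplex \<Longrightarrow> y' \<in> prob_simplex \<Longrightarrow> u \<in> U \<Longrightarrow>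
      v \<in> V \<Longrightarrow> norm (y - y') \<le> K * (b - a) \<Longrightarrow> norm (drift Q t y u v - drift Q a y' u v) \<le> \<epsilon>"
  shows "generator Q h \<tau> u\<^sub>0 v (\<lambda>y. (norm (y - w'))\<^sup>2) x' \<le>
    (2 * m + 2 * K\<^sup>2 * (b - a) + 4 * \<epsilon> + 4 * CARD('d) * K * h) + 8 * K * (if x' = x then 0 else 1)"
proof -
  have ab: "a \<le> b" and \<tau>T: "\<tau> \<in> {0..T}"
    using a b \<tau> by auto
  have uc': "norm (drift Q \<tau> x u\<^sub>0 v - drift Q a x u\<^sub>0 v) \<le> \<epsilon>"
    using ab K_pos by (intro uc \<tau> x u v) auto
  then have \<epsilon>: "0 \<le> \<epsilon>" by (rule order_trans[OF norm_ge_zero])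
  have "(x' - w') \<bullet> drift Q \<tau> x' u\<^sub>0 v \<le> m + K\<^sup>2 * (b - a) + 2 * \<epsilon> + 4 * K * (if x' = x then 0 else 1)"
  proof (cases "x' = x")
    case True
    have "norm (x - w) * norm (drift Q \<tau> x u\<^sub>0 v - drift Q a x u\<^sub>0 v) \<le> 2 * \<epsilon>"
      using uc' by (intro mult_mono norm_diff_prob_simplex x w) auto
    then have 1: "\<bar>(x - w) \<bullet> (drift Q \<tau> x u\<^sub>0 v - drift Q a x u\<^sub>0 v)\<bar> \<le> 2 * \<epsilon>"
      by (rule order_trans[OF Cauchy_Schwarz_ineq2])
    have "norm (w' - w) * K \<le> K * (b - a) * K"
      using ww' K_pos by (intro mult_right_mono) auto
    then have 2: "\<bar>(w' - w) \<bullet> drift Q \<tau> x u\<^sub>0 v\<bar> \<le> K\<^sup>2 * (b - a)"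
      using abs_inner_drift_le[OF \<tau>T x u v, of "w' - w"] by (simp add: power2_eq_square mult_ac)
    have "(x - w') \<bullet> drift Q \<tau> x u\<^sub>0 v = (x - w) \<bullet> drift Q a x u\<^sub>0 v
        + (x - w) \<bullet> (drift Q \<tau> x u\<^sub>0 v - drift Q a x u\<^sub>0 v) - (w' - w) \<bullet> drift Q \<tau> x u\<^sub>0 v"
      by (simp add: inner_diff_left inner_diff_right)
    then show ?thesis using True 1 2 m(1) by simp
  next
    case False
    have "norm (x' - w') * K \<le> 2 * K"
      using K_pos by (intro mult_right_mono norm_diff_prob_simplex x' w') auto
    then have "(x' - w') \<bullet> drift Q \<tau> x' u\<^sub>0 v \<le> 2 * K"
      using abs_inner_drift_le[OF \<tau>T x' u v, of "x' - w'"] by linarith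
    moreover have "0 \<le> K\<^sup>2 * (b - a)" using ab by simp
    \<comment> \<open>The crude bound \<open>2 * K\<close> is at most \<open>m + 4 * K\<close>
      because \<open>m\<close> is at least \<open>- 2 * K\<close>.\<close>
    ultimately show ?thesis using False m(2) \<epsilon> by simp
  qed
  moreover have "h * (\<Sum>i\<in>UNIV. \<Sum>j\<in>UNIV. x' $ i * Q \<tau> x' u\<^sub>0 v $ i $ j *
      (norm (axis j 1 - axis i 1 :: real^'d))\<^sup>2) \<le> h * (CARD('d) * K * 4)"
    using norm_Q_le[OF \<tau>T x' u v] h
    by (intro mult_left_mono order_trans[OF sum_mult_entries_axis_le[OF x']]) simp_all
  ultimately show ?thesis
    using generator_norm_sq[of h Q \<tau> x' u\<^sub>0 v w', OF less_imp_neq[OF h, symmetric] kolmogorov_Q[OF \<tau>T x' u v]]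
    by (cases "x' = x") (simp_all only: refl if_True if_False mult_ac; linarith)+
qed

end

subsection \<open>Expectations along a motion\<close>

text \<open>The process is the pointwise limit of the step processes \<open>Y n\<close>, which read
  \<open>X\<close> at the next grid point to the right. Each \<open>Y n\<close> is jointly
  measurable because its index takes countably many values, and right continuity gives the
  convergence.\<close>

lemma measurable_right_continuous_process:
  fixes X :: "real \<Rightarrow> 'w \<Rightarrow> 'a::metric_space"
  assumes ab: "a \<le> b" and X: "\<And>t. t \<in> {a..b} \<Longrightarrow> X t \<in> borel_measurable M"
    and cont: "\<And>t \<omega>. t \<in> {a..<b} \<Longrightarrow> \<omega> \<in> space M \<Longrightarrow> ((\<lambda>t. X t \<omega>) \<longlongrightarrow> X t \<omega>) (at_right t)"
  shows "(\<lambda>(t, \<omega>). X t \<omega>) \<in> borel_measurable (restrict_space borel {a..b} \<Otimes>\<^sub>M M)"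
proof (rule borel_measurable_LIMSEQ_metric)
  let ?N = "restrict_space borel {a..b} \<Otimes>\<^sub>M M"
  \<comment> \<open>With \<open>j\<close> the floor of \<open>(n + 1) * t\<close>, this is the first
    point of the grid of width \<open>1 / (n + 1)\<close> strictly after \<open>t\<close>, clipped
    to \<open>{a..b}\<close>.\<close>
  define r where "r = (\<lambda>(n::nat) (j::int). max a (min b ((of_int j + 1) / (real n + 1))))"
  define Y where "Y = (\<lambda>n p. X (r n \<lfloor>(real n + 1) * fst p\<rfloor>) (snd p))"
  show "Y n \<in> borel_measurable ?N" for n
    unfolding Y_def
  proof (rule measurable_compose_countable[where f = "\<lambda>j p. X (r n j) (snd p)"])
    show "(\<lambda>p. X (r n j) (snd p)) \<in> borel_measurable ?N" for j
      using ab by (intro measurable_compose[OF measurable_snd X]) (auto simp: r_def)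
    have "fst \<in> ?N \<rightarrow>\<^sub>M borel"
      by (rule measurable_compose[OF measurable_fst measurable_restrict_space1[OF measurable_ident], simplified])
    then show "(\<lambda>p. \<lfloor>(real n + 1) * fst p\<rfloor>) \<in> ?N \<rightarrow>\<^sub>M count_space UNIV"
      by (intro measurable_compose[OF _ measurable_real_floor]) simp
  qed
  fix p assume p: "p \<in> space ?N"
  obtain t \<omega> where [simp]: "p = (t, \<omega>)" by (cases p)
  have t: "t \<in> {a..b}" and \<omega>: "\<omega> \<in> space M"
    using p by (auto simp: space_pair_measure space_restrict_space)
  have gt: "t < (of_int \<lfloor>(real n + 1) * t\<rfloor> + 1) / (real n + 1)" for n :: nat
    by (simp add: pos_less_divide_eq mult.commute)
  have le: "(of_int \<lfloor>(real n + 1) * t\<rfloor> + 1) / (real n + 1) \<le> t + 1 / (real n + 1)" for n :: nat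
  proof -
    have "(of_int \<lfloor>(real n + 1) * t\<rfloor> + 1) / (real n + 1) \<le> ((real n + 1) * t + 1) / (real n + 1)"
      by (intro divide_right_mono) auto
    then show ?thesis by (simp add: add_divide_distrib)
  qed
  have "(\<lambda>n. X (r n \<lfloor>(real n + 1) * t\<rfloor>) \<omega>) \<longlonglongrightarrow> X t \<omega>"
  \<comment> \<open>At the right end the clipping returns \<open>b\<close> itself. Strictly before
    it the clipped points stay strictly above \<open>t\<close>, as \<open>at_right\<close>
    demands.\<close>
  proof (cases "t = b")
    case True
    then have "r n \<lfloor>(real n + 1) * t\<rfloor> = t" for n
      using gt[of n] ab by (simp add: r_def)
    then show ?thesis by simp
  next
    case False
    then have tb: "t \<in> {a..<b}" using t by auto
    have "(\<lambda>n. r n \<lfloor>(real n + 1) * t\<rfloor>) \<longlonglongrightarrow> t"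
    proof (rule tendsto_sandwich)
      show "\<forall>\<^sub>F n in sequentially. t \<le> r n \<lfloor>(real n + 1) * t\<rfloor>"
        using gt t by (intro always_eventually allI) (auto simp: r_def less_imp_le le_max_iff_disj)
      show "\<forall>\<^sub>F n in sequentially. r n \<lfloor>(real n + 1) * t\<rfloor> \<le> t + 1 / (real n + 1)"
        using le t by (intro always_eventually allI) (auto simp: r_def min_le_iff_disj intro: add_increasing2)
      show "(\<lambda>n. t + 1 / (real n + 1)) \<longlonglongrightarrow> t"
        using tendsto_add[OF tendsto_const[of t] LIMSEQ_inverse_real_of_nat]
        by (simp add: inverse_eq_divide add.commute)
    qed simp
    then have "filterlim (\<lambda>n. r n \<lfloor>(real n + 1) * t\<rfloor>) (at_right t) sequentially"
      using gt tb by (intro tendsto_imp_filterlim_at_right always_eventually) (auto simp: r_def less_max_iff_disj)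
    with cont[OF tb \<omega>] show ?thesis
      by (rule filterlim_compose)
  qed
  then show "(\<lambda>n. Y n p) \<longlonglongrightarrow> (case p of (t, \<omega>) \<Rightarrow> X t \<omega>)"
    by (simp add: Y_def)
qed

text \<open>Links the conditional probabilities in \<open>is_motion\<close> to integrals over the
  conditioning event, which can be added up over disjoint events.\<close>

lemma integral_uniform_measure:
  fixes f :: "'a \<Rightarrow> 'b::{banach, second_countable_topology}"
  assumes "finite_measure M" "A \<in> sets M" "0 < measure M A" "f \<in> borel_measurable M"
  shows "(\<integral>x. f x \<partial>uniform_measure M A) = (LINT x:A|M. f x) /\<^sub>R measure M A"
proof -
  interpret finite_measure M by fact
  have "uniform_measure M A = density M (\<lambda>x. ennreal (indicator A x / measure M A))"
    unfolding uniform_measure_def using assms(3)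
    by (intro arg_cong[where f = "density M"] ext)
      (auto simp: emeasure_eq_measure divide_ennreal[symmetric] split: split_indicator)
  then have "(\<integral>x. f x \<partial>uniform_measure M A) = (\<integral>x. (indicator A x / measure M A) *\<^sub>R f x \<partial>M)"
    using integral_density[OF assms(4), of "\<lambda>x. indicator A x / measure M A"] assms(2) by simp
  also have "\<dots> = (\<integral>x. (1 / measure M A) *\<^sub>R (indicator A x *\<^sub>R f x) \<partial>M)"
    by (intro Bochner_Integration.integral_cong) auto
  also have "\<dots> = (1 / measure M A) *\<^sub>R (LINT x:A|M. f x)"
    unfolding set_lebesgue_integral_def by (rule integral_scaleR_right)
  finally show ?thesis by (simp only: inverse_eq_divide)
qed

locale game_run = markov_game T U V Q K + prob_space M
  for T :: real
    and U :: "'u::{metric_space, second_countable_topology} set"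
    and V :: "'v::{metric_space, second_countable_topology} set"
    and Q :: "('u, 'v, 'd::finite) rate_matrix"
    and K :: real
    and M :: "'w measure" +
  fixes F :: "real \<Rightarrow> 'w measure" and h :: real
  assumes filtration_F: "filtration (space M) F"
    and subalgebra_F: "\<And>t. subalgebra M (F t)"
    and h_pos: "0 < h"
begin

lemma space_F: "space (F t) = space M"
  using subalgebra_F[of t] by (simp add: subalgebra_def)

lemma sets_F: "A \<in> sets (F t) \<Longrightarrow> A \<in> sets M"
  using subalgebra_F[of t] by (auto simp: subalgebra_def)

lemma sets_F_mono: "s \<le> t \<Longrightarrow> A \<in> sets (F s) \<Longrightarrow> A \<in> sets (F t)"
  using filtration.sets_F_mono[OF filtration_F] by blast

lemma cond_probsD:
  assumes "P \<in> cond_probs M (F t)"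
  shows "prob_space P" "sets P = sets M" "space P = space M"
proof -
  obtain A where A: "P = uniform_measure M A" "A \<in> sets (F t)" "0 < measure M A"
    using assms by (auto simp: cond_probs_def)
  then show "prob_space P" "sets P = sets M" "space P = space M"
    by (auto simp: emeasure_eq_measure intro!: prob_space_uniform_measure)
qed

text \<open>
  Joint measurability is essential: the equation in \<^const>\<open>is_motion\<close> uses a Bochner integral over
  time, which would have the junk value 0 for a non-measurable integrand.
\<close>

lemma generator_measurable:
  assumes a: "a \<in> {0..T}" and u: "u \<in> U" and X: "is_motion M F T Q h a y (\<lambda>_ _. u) v X"
    and vV: "\<And>t \<omega>. t \<in> {a..T} \<Longrightarrow> \<omega> \<in> space M \<Longrightarrow> v t \<omega> \<in> V"
    and v: "progressively_measurable F a T v"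
  shows "(\<lambda>(t, \<omega>). generator Q h t u (v t \<omega>) f (X t \<omega>)) \<in>
    borel_measurable (restrict_space borel {a..T} \<Otimes>\<^sub>M M)"
proof -
  let ?N = "restrict_space borel {a..T} \<Otimes>\<^sub>M M"
  have N: "fst p \<in> {a..T}" "snd p \<in> space M" if "p \<in> space ?N" for p
    using that by (auto simp: space_pair_measure space_restrict_space)
  have X_grid: "X t \<omega> \<in> grid_simplex h" if "t \<in> {a..T}" "\<omega> \<in> space M" for t \<omega>
    using X that by (simp add: is_motion_def)
  have "(\<lambda>(t, \<omega>). X t \<omega>) \<in> borel_measurable ?N"
  proof (rule measurable_right_continuous_process)
    show "X t \<in> borel_measurable M" if "t \<in> {a..T}" for t
      using X that by (auto simp: is_motion_def intro: measurable_from_subalg[OF subalgebra_F])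
    show "((\<lambda>t. X t \<omega>) \<longlongrightarrow> X t \<omega>) (at_right t)" if "t \<in> {a..<T}" "\<omega> \<in> space M" for t \<omega>
      using X that by (auto simp: is_motion_def cadlag_on_def)
  qed (use a in simp)
  then have "(\<lambda>p. X (fst p) (snd p)) \<in> borel_measurable ?N"
    by (simp add: case_prod_unfold)
  \<comment> \<open>The state is regarded as a discrete variable, so that measurability of the
    generator has to be checked only at each fixed \<open>x\<close>, where just time and
    \<open>v\<close> vary.\<close>
  then have X_meas: "(\<lambda>p. X (fst p) (snd p)) \<in> ?N \<rightarrow>\<^sub>M count_space (grid_simplex h)"
    unfolding measurable_count_space_eq2[OF finite_grid_simplex[OF h_pos]]
    using X_grid[OF N] by (auto intro: measurable_sets)
  \<comment> \<open>Progressive measurability at time \<open>T\<close> is joint measurability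
    relative to \<open>F T\<close>; the identity map from \<open>M\<close> to its subalgebra
    \<open>F T\<close> transfers it to \<open>M\<close>.\<close>
  have "(\<lambda>\<omega>. \<omega>) \<in> M \<rightarrow>\<^sub>M F T"
    by (rule measurable_from_subalg[OF subalgebra_F measurable_ident_sets[OF refl]])
  then have "(\<lambda>p. (fst p, snd p)) \<in> ?N \<rightarrow>\<^sub>M (restrict_space borel {a..T} \<Otimes>\<^sub>M F T)"
    by (intro measurable_Pair measurable_fst measurable_compose[OF measurable_snd, of "\<lambda>\<omega>. \<omega>"])
  moreover have "(\<lambda>(t, \<omega>). v t \<omega>) \<in> borel_measurable (restrict_space borel {a..T} \<Otimes>\<^sub>M F T)"
    using v a by (auto simp: progressively_measurable_def)
  ultimately have v_meas: "(\<lambda>p. v (fst p) (snd p)) \<in> borel_measurable ?N"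
    by (auto dest: measurable_compose)
  have "(\<lambda>p. generator Q h (fst p) u (v (fst p) (snd p)) f x) \<in> borel_measurable ?N"
    if x: "x \<in> grid_simplex h" for x
  proof -
    have "(\<lambda>p. Q (fst p) x u (v (fst p) (snd p)) $ i $ j) \<in> borel_measurable ?N" for i j
    proof -
      \<comment> \<open>Continuity of \<open>Q\<close> is given only on the constraint set, so the
        composition runs through the space restricted to \<open>{0..T} \<times> V\<close>.\<close>
      have "continuous_on ({0..T} \<times> V) (\<lambda>p. (\<lambda>(t, x, u, v). Q t x u v) (fst p, x, u, snd p))"
        using x u by (intro continuous_on_compose2[OF continuous_Q] continuous_intros)
          (auto simp: grid_simplex_def)
      then have "continuous_on ({0..T} \<times> V) (\<lambda>p. Q (fst p) x u (snd p) $ i $ j)"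
        by (intro continuous_intros) simp
      then have 1: "(\<lambda>p. Q (fst p) x u (snd p) $ i $ j) \<in> borel_measurable (restrict_space borel ({0..T} \<times> V))"
        by (rule borel_measurable_continuous_on_restrict)
      have fst: "fst \<in> ?N \<rightarrow>\<^sub>M borel"
        by (rule measurable_compose[OF measurable_fst measurable_restrict_space1[OF measurable_ident], simplified])
      have "(fst p, v (fst p) (snd p)) \<in> {0..T} \<times> V" if "p \<in> space ?N" for p
        using N[OF that] a vV[OF N[OF that]] by simp
      then have 2: "(\<lambda>p. (fst p, v (fst p) (snd p))) \<in> ?N \<rightarrow>\<^sub>M restrict_space borel ({0..T} \<times> V)"
        by (intro measurable_restrict_space2 borel_measurable_Pair fst v_meas Pi_I)
      from measurable_compose[OF 2 1] show ?thesis by simp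
    qed
    then show ?thesis
      unfolding generator_def by (intro borel_measurable_sum borel_measurable_times) simp_all
  qed
  then have "(\<lambda>p. generator Q h (fst p) u (v (fst p) (snd p)) f (X (fst p) (snd p))) \<in> borel_measurable ?N"
    by (rule measurable_compose_countable'[OF _ X_meas])
      (simp_all add: countable_finite finite_grid_simplex[OF h_pos])
  then show ?thesis by (simp add: case_prod_unfold)
qed

text \<open>Finiteness of the grid bounds the jumps of an arbitrary \<open>f\<close>. The bound may
  depend on \<open>f\<close> and \<open>h\<close>, as it only secures integrability.\<close>

lemma generator_bounded:
  obtains B where "\<And>t x u v. t \<in> {0..T} \<Longrightarrow> x \<in> grid_simplex h \<Longrightarrow> u \<in> U \<Longrightarrow> v \<in> V \<Longrightarrow>
    \<bar>generator Q h t u v f x\<bar> \<le> B"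
proof -
  let ?d = "\<lambda>x i j. \<bar>f (x - h *\<^sub>R axis i 1 + h *\<^sub>R axis j 1 :: real^'d) - f x\<bar>"
  let ?c = "\<lambda>x. \<Sum>i\<in>UNIV. \<Sum>j\<in>UNIV. 1 / h * K * ?d x i j"
  show ?thesis
  proof (rule that[of "\<Sum>x\<in>grid_simplex h. ?c x"])
    fix t u v and x :: "real^'d"
    assume *: "t \<in> {0..T}" "x \<in> grid_simplex h" "u \<in> U" "v \<in> V"
    then have x: "x \<in> prob_simplex" by (simp add: grid_simplex_def)
    have "\<bar>Q t x u v $ i $ j\<bar> \<le> K" for i j
      using component_le_norm_cart[of "Q t x u v $ i" j]
        Finite_Cartesian_Product.norm_nth_le[of "Q t x u v" i] norm_Q_le[OF *(1) x *(3,4)]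
      by linarith
    then have "x $ i * \<bar>Q t x u v $ i $ j\<bar> \<le> 1 * K" for i j
      using prob_simplexD(1,2)[OF x] by (intro mult_mono) auto
    then have "\<bar>generator Q h t u v f x\<bar> \<le> ?c x"
      unfolding generator_def using prob_simplexD(1)[OF x] h_pos
      by (intro order_trans[OF sum_abs] sum_mono)
        (simp add: abs_mult divide_right_mono mult_right_mono)
    also have "\<dots> \<le> (\<Sum>x\<in>grid_simplex h. ?c x)"
      using *(2) h_pos K_pos
      by (intro member_le_sum sum_nonneg finite_grid_simplex) (auto intro!: mult_nonneg_nonneg)
    finally show "\<bar>generator Q h t u v f x\<bar> \<le> (\<Sum>x\<in>grid_simplex h. ?c x)" .
  qed
qed

text \<open>Dynkin's formula with the generator replaced by a majorant \<open>g\<close> of the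
  state. The number \<open>c\<close> bounds the expectation of \<open>g\<close>, not
  \<open>g\<close> itself, which allows a majorant that is large only on an unlikely event.\<close>

lemma motion_expectation_le:
  assumes a: "a \<in> {0..T}" and b: "b \<in> {a..T}" and u: "u \<in> U"
    and X: "is_motion M F T Q h a y (\<lambda>_ _. u) v X"
    and vV: "\<And>t \<omega>. t \<in> {a..T} \<Longrightarrow> \<omega> \<in> space M \<Longrightarrow> v t \<omega> \<in> V"
    and v: "progressively_measurable F a T v" and P: "P \<in> cond_probs M (F a)"
    and g: "g \<in> borel_measurable borel" "\<And>x. \<bar>g x\<bar> \<le> B"
    and le: "\<And>t \<omega>. t \<in> {a..b} \<Longrightarrow> \<omega> \<in> space M \<Longrightarrow>
      generator Q h t u (v t \<omega>) f (X t \<omega>) \<le> g (X t \<omega>)"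
    and c: "\<And>t. t \<in> {a..b} \<Longrightarrow> (\<integral>\<omega>. g (X t \<omega>) \<partial>P) \<le> c"
  shows "(\<integral>\<omega>. f (X b \<omega>) \<partial>P) \<le> f y + c * (b - a)"
proof -
  interpret P: prob_space P by (rule cond_probsD(1)[OF P])
  note [measurable_cong] = cond_probsD(2)[OF P]
  let ?G = "\<lambda>t \<omega>. generator Q h t u (v t \<omega>) f (X t \<omega>)"
  have X_grid: "X t \<omega> \<in> grid_simplex h" if "t \<in> {a..T}" "\<omega> \<in> space M" for t \<omega>
    using X that by (simp add: is_motion_def)
  obtain B' where B': "\<And>t x u v. t \<in> {0..T} \<Longrightarrow> x \<in> grid_simplex h \<Longrightarrow> u \<in> U \<Longrightarrow> v \<in> V \<Longrightarrow>
      \<bar>generator Q h t u v f x\<bar> \<le> B'"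
    using generator_bounded by blast
  have G_bound: "\<bar>?G t \<omega>\<bar> \<le> B'" if "t \<in> {a..T}" "\<omega> \<in> space M" for t \<omega>
    using that a u by (intro B' X_grid vV) auto
  have "sets (restrict_space borel {a..T} \<Otimes>\<^sub>M P) = sets (restrict_space borel {a..T} \<Otimes>\<^sub>M M)"
    by (intro sets_pair_measure_cong refl cond_probsD(2)[OF P])
  then have G_meas: "(\<lambda>(t, \<omega>). ?G t \<omega>) \<in> borel_measurable (restrict_space borel {a..T} \<Otimes>\<^sub>M P)"
    using generator_measurable[OF a u X vV v, of f] measurable_cong_sets[OF _ refl] by blast
  have G_int: "integrable P (?G t)" if t: "t \<in> {a..T}" for t
  proof (rule P.integrable_const_bound)
    show "AE \<omega> in P. norm (?G t \<omega>) \<le> B'"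
      using G_bound[OF t] by (intro AE_I2) (simp add: cond_probsD(3)[OF P])
    have "(\<lambda>\<omega>. (t, \<omega>)) \<in> P \<rightarrow>\<^sub>M (restrict_space borel {a..T} \<Otimes>\<^sub>M P)"
      using t by (intro measurable_Pair1') (simp add: space_restrict_space)
    from measurable_compose[OF this G_meas] show "?G t \<in> borel_measurable P" by simp
  qed
  \<comment> \<open>Joint measurability makes the inner expectation a measurable function of time,
    as in Fubini's theorem.\<close>
  have "(\<lambda>t. \<integral>\<omega>. ?G t \<omega> \<partial>P) \<in> borel_measurable (restrict_space borel {a..T})"
    using G_meas by (rule P.borel_measurable_lebesgue_integral)
  then have meas: "(\<lambda>t. indicator {a..T} t *\<^sub>R (\<integral>\<omega>. ?G t \<omega> \<partial>P)) \<in> borel_measurable lborel"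
    by (subst (asm) borel_measurable_restrict_space_iff) auto
  have "set_integrable lborel {a..T} (\<lambda>t. \<integral>\<omega>. ?G t \<omega> \<partial>P)"
    unfolding set_integrable_def
  proof (rule Bochner_Integration.integrable_bound[OF _ meas])
    show "integrable lborel (\<lambda>t. indicator {a..T} t * B')"
      by (intro integrable_mult_left integrable_real_indicator) (auto simp: emeasure_lborel_Icc_eq)
    have "\<bar>\<integral>\<omega>. ?G t \<omega> \<partial>P\<bar> \<le> B'" if t: "t \<in> {a..T}" for t
    proof -
      have "\<bar>\<integral>\<omega>. ?G t \<omega> \<partial>P\<bar> \<le> (\<integral>\<omega>. \<bar>?G t \<omega>\<bar> \<partial>P)"
        by (rule integral_abs_bound)
      also have "\<dots> \<le> (\<integral>\<omega>. B' \<partial>P)"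
        using G_bound[OF t] G_int[OF t] cond_probsD(3)[OF P] by (intro integral_mono) auto
      finally show ?thesis by (simp add: P.prob_space)
    qed
    then show "AE t in lborel. norm (indicator {a..T} t *\<^sub>R (\<integral>\<omega>. ?G t \<omega> \<partial>P)) \<le> norm (indicator {a..T} t * B')"
      by (intro AE_I2) (fastforce split: split_indicator)
  qed
  then have int: "set_integrable lborel {a..b} (\<lambda>t. \<integral>\<omega>. ?G t \<omega> \<partial>P)"
    using b by (auto intro: set_integrable_subset)
  have G_le: "(\<integral>\<omega>. ?G t \<omega> \<partial>P) \<le> c" if t: "t \<in> {a..b}" for t
  proof -
    have tT: "t \<in> {a..T}" using t b by auto
    have "X t \<in> borel_measurable M"
      using X tT by (auto simp: is_motion_def intro: measurable_from_subalg[OF subalgebra_F])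
    then have "integrable P (\<lambda>\<omega>. g (X t \<omega>))"
      using g by (intro P.integrable_const_bound[of _ B]) auto
    then have "(\<integral>\<omega>. ?G t \<omega> \<partial>P) \<le> (\<integral>\<omega>. g (X t \<omega>) \<partial>P)"
      using G_int[OF tT] le[OF t] cond_probsD(3)[OF P] by (intro integral_mono) auto
    then show ?thesis using c[OF t] by linarith
  qed
  have "(\<integral>\<omega>. f (X b \<omega>) \<partial>P) - f y = (LINT t:{a..b}|lborel. \<integral>\<omega>. ?G t \<omega> \<partial>P)"
    using X P b unfolding is_motion_def by blast
  also have "\<dots> \<le> (LINT t:{a..b}|lborel. c)"
    using G_le by (intro set_integral_mono int) (auto simp: set_integrable_def emeasure_lborel_Icc_eq)
  also have "\<dots> = c * (b - a)"
    using b by (subst set_integral_const) auto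
  finally show ?thesis by linarith
qed

end

subsection \<open>One step of the guided motion\<close>

lemma is_partitionD:
  assumes "is_partition s T m t"
  shows "t 0 = s" "t m = T" "k < m \<Longrightarrow> t k < t (Suc k)" "i \<le> j \<Longrightarrow> j \<le> m \<Longrightarrow> t i \<le> t j"
    "k \<le> m \<Longrightarrow> t k \<in> {s..T}"
proof -
  show *: "t 0 = s" "t m = T" and less: "k < m \<Longrightarrow> t k < t (Suc k)" for k
    using assms by (simp_all add: is_partition_def)
  show mono: "t i \<le> t j" if "i \<le> j" "j \<le> m" for i j
    using that
  proof (induction rule: dec_induct)
    case (step n)
    then show ?case using less[of n] by simp
  qed simp
  show "k \<le> m \<Longrightarrow> t k \<in> {s..T}"
    using mono[of 0 k] mono[of k m] * by simp
qed

lemma mesh_le_iff: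
  assumes "0 \<le> \<delta>"
  shows "mesh m t \<le> \<delta> \<longleftrightarrow> (\<forall>k<m. t (Suc k) - t k \<le> \<delta>)"
  using assms by (auto simp: mesh_def)

lemma guided_motion_final:
  assumes "is_partition s T m t"
  shows "guided_motion M F T Q h y S m t v T \<omega> = fst (guided_step M F T Q h y S t v m \<omega>)"
proof -
  have "(GREATEST k. k \<le> m \<and> t k \<le> T) = m"
    using is_partitionD(2)[OF assms] by (intro Greatest_equality) auto
  then show ?thesis
    by (simp add: guided_motion_def Let_def case_prod_unfold)
qed

text \<open>A constant control is deterministic and measurable, so \<open>v\<close> is admissible
  against it; the existence of a motion makes the choice in \<open>motion\<close>
  meaningful.\<close>

lemma motion_is_motion:
  assumes v: "v \<in> stoch_controls M F T U V Q h a" and u: "u \<in> U" and x: "x \<in> grid_simplex h"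
  shows "is_motion M F T Q h a x (\<lambda>_ _. u) v (motion M F T Q h a x (\<lambda>_ _. u) v)"
    and "progressively_measurable F a T v"
    and "t \<in> {a..T} \<Longrightarrow> \<omega> \<in> space M \<Longrightarrow> v t \<omega> \<in> V"
proof -
  have u': "(\<lambda>_. u) \<in> det_controls T U a"
    using u by (simp add: det_controls_def)
  have "\<forall>u\<in>det_controls T U a. admissible M F T U V Q h a (\<lambda>t \<omega>. u t) v"
    using v unfolding stoch_controls_def by (rule CollectD)
  from bspec[OF this u'] have adm: "admissible M F T U V Q h a (\<lambda>_ _. u) v" .
  then show "progressively_measurable F a T v" "t \<in> {a..T} \<Longrightarrow> \<omega> \<in> space M \<Longrightarrow> v t \<omega> \<in> V"
    by (simp_all add: admissible_def)
  have "\<exists>X. is_motion M F T Q h a x (\<lambda>_ _. u) v X"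
    using adm x unfolding admissible_def by blast
  then show "is_motion M F T Q h a x (\<lambda>_ _. u) v (motion M F T Q h a x (\<lambda>_ _. u) v)"
    unfolding motion_def by (rule someI_ex)
qed

context markov_game
begin

text \<open>The tolerance \<open>\<delta>\<close> in time goes with \<open>K * \<delta>\<close> in
  the state, because the guide travels at most that far during a step of length
  \<open>\<delta>\<close>.\<close>

definition drift_modulus :: "real \<Rightarrow> real \<Rightarrow> bool" where
  "drift_modulus \<delta> \<epsilon> \<longleftrightarrow> (\<forall>t\<in>{0..T}. \<forall>t'\<in>{0..T}. \<forall>x\<in>prob_simplex. \<forall>x'\<in>prob_simplex. \<forall>u\<in>U. \<forall>v\<in>V.
     \<bar>t - t'\<bar> \<le> \<delta> \<longrightarrow> norm (x - x') \<le> K * \<delta> \<longrightarrow> norm (drift Q t x u v - drift Q t' x' u v) \<le> \<epsilon>)"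

lemma drift_modulusD:
  assumes "drift_modulus \<delta> \<epsilon>" "t \<in> {0..T}" "t' \<in> {0..T}" "x \<in> prob_simplex" "x' \<in> prob_simplex"
    "u \<in> U" "v \<in> V" "\<bar>t - t'\<bar> \<le> \<delta>" "norm (x - x') \<le> K * \<delta>"
  shows "norm (drift Q t x u v - drift Q t' x' u v) \<le> \<epsilon>"
  using assms unfolding drift_modulus_def by blast

lemma ex_drift_modulus:
  assumes "0 < \<epsilon>"
  obtains \<delta>\<^sub>0 where "0 < \<delta>\<^sub>0" "\<And>\<delta>. \<delta> \<le> \<delta>\<^sub>0 \<Longrightarrow> drift_modulus \<delta> \<epsilon>"
proof -
  obtain \<delta> where \<delta>: "0 < \<delta>" and uc:
    "\<And>t t' x x' u v. t \<in> {0..T} \<Longrightarrow> t' \<in> {0..T} \<Longrightarrow> x \<in> prob_simplex \<Longrightarrow> x' \<in> prob_simplex \<Longrightarrow>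
      u \<in> U \<Longrightarrow> v \<in> V \<Longrightarrow> \<bar>t - t'\<bar> < \<delta> \<Longrightarrow> norm (x - x') < \<delta> \<Longrightarrow>
      norm (drift Q t x u v - drift Q t' x' u v) \<le> \<epsilon>"
    using drift_uniformly_continuous[OF assms] by metis
  show ?thesis
  \<comment> \<open>Halving leaves room between the weak inequalities of
    \<open>drift_modulus\<close> and the strict ones of uniform continuity; the second term does so
    for \<open>K * \<delta>\<close>.\<close>
  proof (rule that[of "min (\<delta> / 2) (\<delta> / (2 * K))"])
    show "0 < min (\<delta> / 2) (\<delta> / (2 * K))" using \<delta> K_pos by simp
    fix \<delta>' assume "\<delta>' \<le> min (\<delta> / 2) (\<delta> / (2 * K))"
    then have "\<delta>' < \<delta>" "K * \<delta>' < \<delta>"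
      using \<delta> K_pos by (auto simp: field_simps)
    then show "drift_modulus \<delta>' \<epsilon>"
      unfolding drift_modulus_def by (intro ballI impI uc) auto
  qed
qed

lemma extremal_strategy_guide:
  assumes "extremal_strategy T U V Q \<zeta> S" "solution_choice T U V Q \<phi> \<zeta>"
    "a \<in> {0..T}" "b \<in> {a<..T}" "x \<in> prob_simplex" "w \<in> prob_simplex"
  shows "control S a x w \<in> U" "guide S b a x w \<in> prob_simplex" "\<phi> b (guide S b a x w) \<le> \<phi> a w"
proof -
  obtain v\<^sub>0 z m where "solves_inclusion U Q v\<^sub>0 a b w z" "\<phi> b (z b) \<le> \<phi> a w"
    "guide S b a x w = z b" "control S a x w \<in> U"
    by (rule extremal_strategyE[OF assms]) (rule that)
  then show "control S a x w \<in> U" "guide S b a x w \<in> prob_simplex" "\<phi> b (guide S b a x w) \<le> \<phi> a w"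
    using assms(4) by (simp_all add: solves_inclusion_def)
qed

end

context game_run
begin

text \<open>For fixed \<open>x\<close> and \<open>w\<close>, Dynkin's formula is applied to the
  squared distance to the guide's next state, and then that distance is expanded at
  \<open>w\<close>. The value \<open>m\<close> of the local game enters the two bounds with opposite
  signs.\<close>

lemma motion_step_le:
  assumes S: "extremal_strategy T U V Q \<zeta> S" and \<zeta>: "solution_choice T U V Q \<phi> \<zeta>"
    and a: "a \<in> {0..T}" and b: "b \<in> {a<..T}"
    and x: "x \<in> grid_simplex h" and w: "w \<in> prob_simplex"
    and X: "is_motion M F T Q h a x (\<lambda>_ _. control S a x w) v X"
    and vV: "\<And>t \<omega>. t \<in> {a..T} \<Longrightarrow> \<omega> \<in> space M \<Longrightarrow> v t \<omega> \<in> V"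
    and v: "progressively_measurable F a T v" and P: "P \<in> cond_probs M (F a)"
    and modulus: "drift_modulus (b - a) \<epsilon>"
  shows "(\<integral>\<omega>. (norm (X b \<omega> - guide S b a x w))\<^sup>2 \<partial>P) \<le> (1 + 2 * L * (b - a)) * (norm (x - w))\<^sup>2
    + (b - a) * (4 * CARD('d) * K * h + 8 * \<epsilon> + (3 * K\<^sup>2 + 8 * CARD('d) * K\<^sup>2 / h) * (b - a))"
proof -
  interpret P: prob_space P by (rule cond_probsD(1)[OF P])
  note [measurable_cong] = cond_probsD(2)[OF P]
  have xS: "x \<in> prob_simplex" using x by (simp add: grid_simplex_def)
  obtain v\<^sub>0 z m where v0: "v\<^sub>0 \<in> V" and z: "solves_inclusion U Q v\<^sub>0 a b w z"
    and w': "guide S b a x w = z b" and u: "control S a x w \<in> U"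
    and m: "\<And>v. v \<in> V \<Longrightarrow> (x - w) \<bullet> drift Q a x (control S a x w) v \<le> m"
      "\<And>u. u \<in> U \<Longrightarrow> m \<le> (x - w) \<bullet> drift Q a x u v\<^sub>0"
    by (rule extremal_strategyE[OF S \<zeta> a b xS w]) (rule that)
  let ?u = "control S a x w" and ?\<Delta> = "b - a" and ?N = "real CARD('d)"
  have ab: "a < b" using b by simp
  have uc: "norm (drift Q t y u v - drift Q a y' u v) \<le> \<epsilon>"
    if "t \<in> {a..b}" "y \<in> prob_simplex" "y' \<in> prob_simplex" "u \<in> U" "v \<in> V" "norm (y - y') \<le> K * (b - a)"
    for t y y' u v
    using that a b by (intro drift_modulusD[OF modulus]) auto
  have zS: "z b \<in> prob_simplex"
    using z ab unfolding solves_inclusion_def by simp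
  \<comment> \<open>\<open>m\<close> is at least the product attained against
    \<open>v\<^sub>0\<close>, and that product has modulus at most \<open>2 * K\<close>.\<close>
  have m_ge: "- 2 * K \<le> m"
  proof -
    have "norm (x - w) * K \<le> 2 * K"
      using K_pos by (intro mult_right_mono norm_diff_prob_simplex xS w) auto
    then show ?thesis
      using m(1)[OF v0] abs_inner_drift_le[OF a xS u v0, of "x - w"] by linarith
  qed
  have X_grid: "X t \<omega> \<in> grid_simplex h" if "t \<in> {a..b}" "\<omega> \<in> space M" for t \<omega>
    using X that b by (simp add: is_motion_def)
  have X_meas: "X t \<in> borel_measurable M" if "t \<in> {a..b}" for t
    using X that b by (auto simp: is_motion_def intro: measurable_from_subalg[OF subalgebra_F])
  \<comment> \<open>It suffices that the state leaves \<open>x\<close> before time \<open>b\<close> with a probability of order \<open>b - a\<close>,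
    with a constant that depends on \<open>h\<close>.\<close>
  define jump where "jump = (\<lambda>y::real^'d. if y = x then 0 else 1 :: real)"
  have jump_meas: "jump \<in> borel_measurable borel"
    unfolding jump_def by simp
  have jump_le: "(\<integral>\<omega>. jump (X t \<omega>) \<partial>P) \<le> ?N * K / h * ?\<Delta>" if t: "t \<in> {a..b}" for t
  proof -
    \<comment> \<open>The equation of motion admits arbitrary test functions, hence also
      \<open>jump\<close>; its expectation is the probability of not being at
      \<open>x\<close>.\<close>
    have "(\<integral>\<omega>. jump (X t \<omega>) \<partial>P) \<le> jump x + ?N * K / h * (t - a)"
    proof (rule motion_expectation_le[OF a _ u X vV v P, where g = "\<lambda>_. ?N * K / h" and B = "?N * K / h"])
      show "t \<in> {a..T}" using t b by auto
      fix \<tau> \<omega> assume \<tau>: "\<tau> \<in> {a..t}" and \<omega>: "\<omega> \<in> space M"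
      then have \<tau>': "\<tau> \<in> {0..T}" "\<tau> \<in> {a..b}" "\<tau> \<in> {a..T}" using t a b by auto
      then have XS: "X \<tau> \<omega> \<in> prob_simplex" using X_grid[OF _ \<omega>] by (simp add: grid_simplex_def)
      have "generator Q h \<tau> ?u (v \<tau> \<omega>) jump (X \<tau> \<omega>) \<le> ?N * norm (Q \<tau> (X \<tau> \<omega>) ?u (v \<tau> \<omega>)) * 1 / h"
        by (rule generator_le[OF h_pos XS]) (simp add: jump_def)
      also have "\<dots> \<le> ?N * K * 1 / h"
        using h_pos norm_Q_le[OF \<tau>'(1) XS u vV[OF \<tau>'(3) \<omega>]]
        by (intro divide_right_mono mult_right_mono mult_left_mono) auto
      finally show "generator Q h \<tau> ?u (v \<tau> \<omega>) jump (X \<tau> \<omega>) \<le> ?N * K / h" by simp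
    qed (use h_pos K_pos P.prob_space in auto)
    also have "\<dots> \<le> ?N * K / h * ?\<Delta>"
      using t h_pos K_pos by (simp add: jump_def divide_right_mono mult_left_mono)
    finally show ?thesis .
  qed
  define C where "C = 2 * m + 2 * K\<^sup>2 * ?\<Delta> + 4 * \<epsilon> + 4 * CARD('d) * K * h"
  \<comment> \<open>The guide's next state \<open>z b\<close> is determined by the data at time
    \<open>a\<close>, so it is a constant here and the squared distance to it is a legitimate test
    function.\<close>
  have "(\<integral>\<omega>. (norm (X b \<omega> - z b))\<^sup>2 \<partial>P) \<le> (norm (x - z b))\<^sup>2 + (C + 8 * K * (?N * K / h * ?\<Delta>)) * ?\<Delta>"
  proof (rule motion_expectation_le[OF a _ u X vV v P,
      where f = "\<lambda>y. (norm (y - z b))\<^sup>2" and g = "\<lambda>y. C + 8 * K * jump y" and B = "\<bar>C\<bar> + 8 * K"])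
    show "b \<in> {a..T}" using ab b by simp
    show "(\<lambda>y. C + 8 * K * jump y) \<in> borel_measurable borel"
      using jump_meas by simp
    show "\<bar>C + 8 * K * jump y\<bar> \<le> \<bar>C\<bar> + 8 * K" for y
      using K_pos abs_triangle_ineq[of C "8 * K"] by (simp add: jump_def)
    fix t assume t: "t \<in> {a..b}"
    show "generator Q h t ?u (v t \<omega>) (\<lambda>y. (norm (y - z b))\<^sup>2) (X t \<omega>) \<le> C + 8 * K * jump (X t \<omega>)"
      if \<omega>: "\<omega> \<in> space M" for \<omega>
    proof -
      have vt: "v t \<omega> \<in> V" using t b \<omega> by (intro vV) auto
      have XS: "X t \<omega> \<in> prob_simplex" using X_grid[OF t \<omega>] by (simp add: grid_simplex_def)
      show ?thesis
        unfolding C_def jump_def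
        by (rule generator_sq_step_le[OF h_pos a b t xS w zS XS u vt
              guide_step_le(1)[OF a b xS w v0 z m(2) uc] m(1)[OF vt] m_ge uc])
    qed
    have "integrable P (\<lambda>\<omega>. jump (X t \<omega>))"
      using measurable_compose[OF X_meas[OF t] jump_meas]
      by (intro P.integrable_const_bound[of _ 1]) (auto simp: jump_def)
    then have "(\<integral>\<omega>. C + 8 * K * jump (X t \<omega>) \<partial>P) = C + 8 * K * (\<integral>\<omega>. jump (X t \<omega>) \<partial>P)"
      by (simp add: P.prob_space)
    also have "\<dots> \<le> C + 8 * K * (?N * K / h * ?\<Delta>)"
      using jump_le[OF t] K_pos by (intro add_left_mono mult_left_mono) auto
    finally show "(\<integral>\<omega>. C + 8 * K * jump (X t \<omega>) \<partial>P) \<le> C + 8 * K * (?N * K / h * ?\<Delta>)" .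
  qed
  also have "\<dots> \<le> (norm (x - w))\<^sup>2 - 2 * ?\<Delta> * (m - L * (norm (x - w))\<^sup>2 - 2 * \<epsilon>) + (K * ?\<Delta>)\<^sup>2
      + (C + 8 * K * (?N * K / h * ?\<Delta>)) * ?\<Delta>"
    by (intro add_right_mono guide_step_le(2)[OF a b xS w v0 z m(2) uc])
  \<comment> \<open>The \<open>2 * m\<close> in \<open>C\<close> cancels the guide's
    \<open>- 2 * ?\<Delta> * m\<close>. The coefficient 3 of \<open>K\<^sup>2\<close> collects 2
    from \<open>C\<close> and 1 from the guide's displacement; of \<open>8 * \<epsilon>\<close> each
    of the two bounds supplies half.\<close>
  also have "\<dots> = (1 + 2 * L * ?\<Delta>) * (norm (x - w))\<^sup>2
      + ?\<Delta> * (4 * CARD('d) * K * h + 8 * \<epsilon> + (3 * K\<^sup>2 + 8 * CARD('d) * K\<^sup>2 / h) * ?\<Delta>)"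
    unfolding C_def by (simp add: power2_eq_square algebra_simps add_divide_distrib diff_divide_distrib)
  finally show ?thesis unfolding w' .
qed

text \<open>\<open>cond_probs\<close> covers only non-null events; on a null event both sides are 0.
  Unlike conditional expectations, set integrals add up over a finite splitting of an event.\<close>

lemma set_integral_le_cond_probs:
  fixes g :: "'w \<Rightarrow> real"
  assumes A: "A \<in> sets (F a)" and g: "g \<in> borel_measurable M"
    and le: "\<And>P. P \<in> cond_probs M (F a) \<Longrightarrow> (\<integral>\<omega>. g \<omega> \<partial>P) \<le> c"
  shows "(LINT \<omega>:A|M. g \<omega>) \<le> c * measure M A"
proof (cases "measure M A = 0")
  case True
  then have "AE \<omega> in M. \<omega> \<notin> A"
    using sets_F[OF A] by (intro AE_not_in) (simp add: null_sets_def emeasure_eq_measure)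
  then have "(LINT \<omega>:A|M. g \<omega>) = 0"
    unfolding set_lebesgue_integral_def by (intro integral_eq_zero_AE) auto
  with True show ?thesis by simp
next
  case False
  then have pos: "0 < measure M A" using zero_less_measure_iff by blast
  then have "uniform_measure M A \<in> cond_probs M (F a)"
    using A by (auto simp: cond_probs_def)
  from le[OF this] have "(LINT \<omega>:A|M. g \<omega>) / measure M A \<le> c"
    using integral_uniform_measure[OF finite_measure_axioms sets_F[OF A] pos g]
    by (simp add: divide_inverse mult.commute)
  with pos show ?thesis by (simp add: pos_divide_le_eq)
qed

end

subsection \<open>The Gronwall estimate\<close>

context game_run
begin

lemma finite_valued_measurable:
  fixes g :: "'b \<Rightarrow> real"
  assumes G: "finite G" "\<And>\<omega>. \<omega> \<in> space M \<Longrightarrow> X \<omega> \<in> G"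
    and X: "\<And>q. {\<omega> \<in> space M. X \<omega> = q} \<in> sets M"
  shows "(\<lambda>\<omega>. g (X \<omega>)) \<in> borel_measurable M"
    and "\<omega> \<in> space M \<Longrightarrow> \<bar>g (X \<omega>)\<bar> \<le> (\<Sum>q\<in>G. \<bar>g q\<bar>)"
proof -
  have "X -` {q} \<inter> space M = {\<omega> \<in> space M. X \<omega> = q}" for q
    by blast
  with G X have "X \<in> M \<rightarrow>\<^sub>M count_space G"
    by (simp add: measurable_count_space_eq2)
  then show "(\<lambda>\<omega>. g (X \<omega>)) \<in> borel_measurable M"
    by (rule measurable_compose) simp
  show "\<bar>g (X \<omega>)\<bar> \<le> (\<Sum>q\<in>G. \<bar>g q\<bar>)" if "\<omega> \<in> space M"
    by (rule member_le_sum) (use G that in auto)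
qed

text \<open>Induction over the steps. As \<open>step k\<close> has finitely many values, an event of
  \<open>F s\<close> splits into finitely many events of \<open>F (t k)\<close> on which state and
  guide are constant and \<open>motion_step_le\<close> applies. The estimate is carried as set
  integrals because the conditioning of the result is on events at time \<open>s\<close>, that of
  one step on events at time \<open>t k\<close>.\<close>

lemma guided_step_estimate:
  fixes S :: "('u, 'd) guide_strategy" and y :: "real^'d" and t :: "nat \<Rightarrow> real"
    and v :: "('w, 'v) process" and step :: "nat \<Rightarrow> 'w \<Rightarrow> (real^'d) \<times> (real^'d)"
    and D :: "(real^'d) \<times> (real^'d) \<Rightarrow> real"
  defines "step \<equiv> guided_step M F T Q h y S t v"
    and "D \<equiv> \<lambda>q. (norm (fst q - snd q))\<^sup>2"
  assumes S: "extremal_strategy T U V Q \<zeta> S" and \<zeta>: "solution_choice T U V Q \<phi> \<zeta>"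
    and s: "s \<in> {0..T}" and y: "y \<in> grid_simplex h" and partition: "is_partition s T m t"
    and v: "\<forall>k\<le>m. v \<in> stoch_controls M F T U V Q h (t k)"
    and mesh: "\<forall>k<m. t (Suc k) - t k \<le> \<delta>"
    and modulus: "\<forall>\<delta>'\<le>\<delta>. drift_modulus \<delta>' \<epsilon>"
    and \<epsilon>: "8 * \<epsilon> + (3 * K\<^sup>2 + 8 * CARD('d) * K\<^sup>2 / h) * \<delta> \<le> \<eta>" and \<eta>: "0 \<le> \<eta>"
    and k: "k \<le> m"
  shows "\<exists>G. finite G \<and> G \<subseteq> grid_simplex h \<times> prob_simplex \<and> (\<forall>\<omega>\<in>space M. step k \<omega> \<in> G) \<and>
    (\<forall>q. {\<omega> \<in> space M. step k \<omega> = q} \<in> sets (F (t k))) \<and> (\<forall>q\<in>G. \<phi> (t k) (snd q) \<le> \<phi> s y) \<and>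
    (\<forall>A\<in>sets (F s). (LINT \<omega>:A|M. D (step k \<omega>)) \<le>
      exp (2 * L * (t k - s)) * (t k - s) * (4 * CARD('d) * K * h + \<eta>) * measure M A)"
  using k
proof (induction k)
  case 0
  have "y \<in> prob_simplex" using y by (simp add: grid_simplex_def)
  then have step0: "step 0 = (\<lambda>_. (y, y))"
    using S s is_partitionD(1)[OF partition] by (auto simp: step_def extremal_strategy_def)
  have t0: "t 0 = s" by (rule is_partitionD(1)[OF partition])
  show ?case
  proof (intro exI[of _ "{(y, y)}"] conjI ballI allI)
    show "{(y, y)} \<subseteq> grid_simplex h \<times> prob_simplex"
      using y \<open>y \<in> prob_simplex\<close> by simp
    show "{\<omega> \<in> space M. step 0 \<omega> = q} \<in> sets (F (t 0))" for q
      using sets.top[of "F (t 0)"] by (cases "(y, y) = q") (simp_all add: step0 space_F)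
    show "(LINT \<omega>:A|M. D (step 0 \<omega>)) \<le>
      exp (2 * L * (t 0 - s)) * (t 0 - s) * (4 * CARD('d) * K * h + \<eta>) * measure M A" for A
      by (simp add: step0 t0 D_def set_lebesgue_integral_def)
  qed (simp_all add: step0 t0)
next
  case (Suc k)
  then have "k \<le> m" by simp
  from Suc.IH[OF this] obtain G where G0: "finite G" "G \<subseteq> grid_simplex h \<times> prob_simplex"
      "\<forall>\<omega>\<in>space M. step k \<omega> \<in> G" "\<forall>q. {\<omega> \<in> space M. step k \<omega> = q} \<in> sets (F (t k))"
      "\<forall>q\<in>G. \<phi> (t k) (snd q) \<le> \<phi> s y"
    and IH: "\<forall>A\<in>sets (F s). (LINT \<omega>:A|M. D (step k \<omega>)) \<le>
      exp (2 * L * (t k - s)) * (t k - s) * (4 * CARD('d) * K * h + \<eta>) * measure M A"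
    by (elim exE conjE)
  note G = G0(1,2) G0(3)[rule_format] G0(4)[rule_format] G0(5)[rule_format]
  define a b where "a = t k" and "b = t (Suc k)"
  have km: "k < m" "k \<le> m" using Suc.prems by auto
  have ab: "a < b" using is_partitionD(3)[OF partition km(1)] by (simp add: a_def b_def)
  have sa: "s \<le> a" and a: "a \<in> {0..T}" and b: "b \<in> {a<..T}"
    using is_partitionD(5)[OF partition km(2)] is_partitionD(5)[OF partition Suc.prems] s ab
    by (auto simp: a_def b_def)
  define u where "u = (\<lambda>q. control S a (fst q) (snd q))"
  define X where "X = (\<lambda>q. motion M F T Q h a (fst q) (\<lambda>_ _. u q) v)"
  define w where "w = (\<lambda>q. guide S b a (fst q) (snd q))"
  have step_Suc: "step (Suc k) \<omega> = (X (step k \<omega>) b \<omega>, w (step k \<omega>))" for \<omega>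
    by (simp add: step_def X_def u_def w_def a_def b_def Let_def case_prod_unfold)
  have qG: "fst q \<in> grid_simplex h" "fst q \<in> prob_simplex" "snd q \<in> prob_simplex" if "q \<in> G" for q
    using G(2) that by (auto simp: grid_simplex_def)
  have strategy: "u q \<in> U" "w q \<in> prob_simplex" "\<phi> b (w q) \<le> \<phi> a (snd q)" if "q \<in> G" for q
    using extremal_strategy_guide[OF S \<zeta> a b qG(2,3)[OF that]] by (simp_all add: u_def w_def)
  have v_a: "v \<in> stoch_controls M F T U V Q h a"
    using v[rule_format, OF km(2)] by (simp add: a_def)
  have motion: "is_motion M F T Q h a (fst q) (\<lambda>_ _. u q) v (X q)" if "q \<in> G" for q
    unfolding X_def by (rule motion_is_motion(1)[OF v_a strategy(1)[OF that] qG(1)[OF that]])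
  have X_meas: "X q b \<in> F b \<rightarrow>\<^sub>M borel" if "q \<in> G" for q
    using motion[OF that] b by (simp add: is_motion_def)
  have X_grid: "X q b \<omega> \<in> grid_simplex h" if "q \<in> G" "\<omega> \<in> space M" for q \<omega>
    using motion[OF that(1)] that(2) b by (simp add: is_motion_def)
  have levels: "{\<omega> \<in> space M. step (Suc k) \<omega> = p} \<in> sets (F b)" for p
  proof -
    \<comment> \<open>\<open>w q\<close> is not random, so the guide reaches \<open>snd p\<close>
      exactly on the level sets of those \<open>q\<close> with \<open>w q = snd p\<close>; on each
      of these the new state is \<open>X q b\<close>.\<close>
    have "{\<omega> \<in> space M. step (Suc k) \<omega> = p} =
        (\<Union>q\<in>{q \<in> G. w q = snd p}. {\<omega> \<in> space M. step k \<omega> = q} \<inter> (X q b -` {fst p} \<inter> space (F b)))"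
      using G(3) by (cases p) (auto simp: step_Suc space_F)
    also have "\<dots> \<in> sets (F b)"
    proof (rule sets.finite_UN)
      show "finite {q \<in> G. w q = snd p}" using G(1) by simp
      fix q assume "q \<in> {q \<in> G. w q = snd p}"
      then have q: "q \<in> G" by simp
      have "{\<omega> \<in> space M. step k \<omega> = q} \<in> sets (F b)"
        using ab by (intro sets_F_mono[OF _ G(4)]) (simp add: a_def)
      then show "{\<omega> \<in> space M. step k \<omega> = q} \<inter> (X q b -` {fst p} \<inter> space (F b)) \<in> sets (F b)"
        by (intro sets.Int[OF _ measurable_sets[OF X_meas[OF q]]]) simp_all
    qed
    finally show ?thesis .
  qed
  let ?G = "grid_simplex h \<times> w ` G"
  have finite: "finite ?G"
    by (intro finite_cartesian_product finite_imageI G(1) finite_grid_simplex h_pos)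
  have range: "step (Suc k) \<omega> \<in> ?G" if "\<omega> \<in> space M" for \<omega>
    using G(3)[OF that] X_grid[OF _ that] by (simp add: step_Suc)
  have D_meas: "(\<lambda>\<omega>. D (step (Suc k) \<omega>)) \<in> borel_measurable M" "(\<lambda>\<omega>. D (step k \<omega>)) \<in> borel_measurable M"
    using finite_valued_measurable(1)[OF finite range sets_F[OF levels], of D]
      finite_valued_measurable(1)[OF G(1,3) sets_F[OF G(4)], of D] by simp_all
  have D_int: "integrable M (\<lambda>\<omega>. D (step (Suc k) \<omega>))" "integrable M (\<lambda>\<omega>. D (step k \<omega>))"
    using finite_valued_measurable(2)[OF finite range sets_F[OF levels], of _ D]
      finite_valued_measurable(2)[OF G(1,3) sets_F[OF G(4)], of _ D] D_meas
    by (auto intro!: integrable_const_bound AE_I2)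
  let ?\<Delta> = "b - a" and ?c = "4 * CARD('d) * K * h + \<eta>"
  have c: "0 \<le> ?c" using K_pos h_pos \<eta> by simp
  have \<Delta>: "0 < ?\<Delta>" "?\<Delta> \<le> \<delta>" using ab mesh[rule_format, OF km(1)] by (simp_all add: a_def b_def)
  have estimate: "(LINT \<omega>:A|M. D (step (Suc k) \<omega>)) \<le>
      exp (2 * L * (b - s)) * (b - s) * ?c * measure M A" if A: "A \<in> sets (F s)" for A
  proof -
    define B where "B = (\<lambda>q. A \<inter> {\<omega> \<in> space M. step k \<omega> = q})"
    have B: "B q \<in> sets (F a)" for q
      using sets_F_mono[OF sa A] G(4)[of q] by (auto simp: B_def a_def)
    have A_eq: "A = (\<Union>q\<in>G. B q)"
      using G(3) sets.sets_into_space[OF sets_F[OF A]] by (auto simp: B_def)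
    have disj: "disjoint_family_on B G"
      by (auto simp: disjoint_family_on_def B_def)
    have set_int: "set_integrable M (B q) f" if "integrable M f" for q and f :: "'w \<Rightarrow> real"
      using that sets_F[OF B] unfolding set_integrable_def by (intro integrable_mult_indicator) auto
    have B_step: "(LINT \<omega>:B q|M. D (step (Suc k) \<omega>)) \<le> ((1 + 2 * L * ?\<Delta>) * D q + ?\<Delta> * ?c) * measure M (B q)"
      if q: "q \<in> G" for q
    proof -
      \<comment> \<open>On \<open>B q\<close> the random initial data equal the constant
        \<open>q\<close>, so the composite motion coincides there with the single motion
        \<open>X q\<close>.\<close>
      have "(LINT \<omega>:B q|M. D (step (Suc k) \<omega>)) = (LINT \<omega>:B q|M. (norm (X q b \<omega> - w q))\<^sup>2)"
        using sets_F[OF B] by (intro set_lebesgue_integral_cong) (auto simp: B_def step_Suc D_def)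
      also have "\<dots> \<le> ((1 + 2 * L * ?\<Delta>) * D q + ?\<Delta> * ?c) * measure M (B q)"
      proof (rule set_integral_le_cond_probs[OF B])
        have "X q b \<in> borel_measurable M"
          by (rule measurable_from_subalg[OF subalgebra_F X_meas[OF q]])
        then show "(\<lambda>\<omega>. (norm (X q b \<omega> - w q))\<^sup>2) \<in> borel_measurable M" by simp
        fix P assume P: "P \<in> cond_probs M (F a)"
        have "(\<integral>\<omega>. (norm (X q b \<omega> - w q))\<^sup>2 \<partial>P) \<le> (1 + 2 * L * ?\<Delta>) * D q
            + ?\<Delta> * (4 * CARD('d) * K * h + 8 * \<epsilon> + (3 * K\<^sup>2 + 8 * CARD('d) * K\<^sup>2 / h) * ?\<Delta>)"
          unfolding w_def D_def
          by (rule motion_step_le[OF S \<zeta> a b qG(1,3)[OF q] motion[OF q, unfolded u_def]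
                motion_is_motion(3)[OF v_a strategy(1)[OF q] qG(1)[OF q]]
                motion_is_motion(2)[OF v_a strategy(1)[OF q] qG(1)[OF q]] P modulus[rule_format, OF \<Delta>(2)]])
        also have "\<dots> \<le> (1 + 2 * L * ?\<Delta>) * D q + ?\<Delta> * ?c"
        proof -
          have "(3 * K\<^sup>2 + 8 * CARD('d) * K\<^sup>2 / h) * ?\<Delta> \<le> (3 * K\<^sup>2 + 8 * CARD('d) * K\<^sup>2 / h) * \<delta>"
            using \<Delta> h_pos by (intro mult_left_mono) auto
          then show ?thesis using \<epsilon> \<Delta> by (intro add_left_mono mult_left_mono) auto
        qed
        finally show "(\<integral>\<omega>. (norm (X q b \<omega> - w q))\<^sup>2 \<partial>P) \<le> (1 + 2 * L * ?\<Delta>) * D q + ?\<Delta> * ?c" .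
      qed
      finally show ?thesis .
    qed
    have B_D: "(LINT \<omega>:B q|M. D (step k \<omega>)) = D q * measure M (B q)" for q
    proof -
      have "(LINT \<omega>:B q|M. D (step k \<omega>)) = (LINT \<omega>:B q|M. D q)"
        using sets_F[OF B] by (intro set_lebesgue_integral_cong) (auto simp: B_def)
      also have "\<dots> = D q * measure M (B q)"
        using sets_F[OF B] by (subst set_integral_const) (auto simp: emeasure_eq_measure)
      finally show ?thesis .
    qed
    have "(LINT \<omega>:A|M. D (step (Suc k) \<omega>)) = (\<Sum>q\<in>G. LINT \<omega>:B q|M. D (step (Suc k) \<omega>))"
      unfolding A_eq by (rule set_integral_finite_Union[OF G(1) disj set_int[OF D_int(1)] sets_F[OF B]])
    also have "\<dots> \<le> (\<Sum>q\<in>G. ((1 + 2 * L * ?\<Delta>) * D q + ?\<Delta> * ?c) * measure M (B q))"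
      by (rule sum_mono) (rule B_step)
    also have "\<dots> = (1 + 2 * L * ?\<Delta>) * (\<Sum>q\<in>G. D q * measure M (B q)) + ?\<Delta> * ?c * (\<Sum>q\<in>G. measure M (B q))"
      by (simp add: distrib_right sum.distrib sum_distrib_left mult.assoc)
    also have "(\<Sum>q\<in>G. D q * measure M (B q)) = (LINT \<omega>:A|M. D (step k \<omega>))"
      unfolding B_D[symmetric] A_eq
      by (rule set_integral_finite_Union[OF G(1) disj set_int[OF D_int(2)] sets_F[OF B], symmetric])
    also have "(\<Sum>q\<in>G. measure M (B q)) = measure M A"
      unfolding A_eq using sets_F[OF B] by (intro finite_measure_finite_Union[OF G(1) _ disj, symmetric]) auto
    \<comment> \<open>The Gronwall step: \<open>1 + 2 * L * ?\<Delta>\<close> is at most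
      \<open>exp (2 * L * ?\<Delta>)\<close>, and the newly added error may be inflated by
      \<open>exp (2 * L * (b - s))\<close>, which is at least 1.\<close>
    also have "(1 + 2 * L * ?\<Delta>) * (LINT \<omega>:A|M. D (step k \<omega>)) + ?\<Delta> * ?c * measure M A \<le>
        exp (2 * L * ?\<Delta>) * (exp (2 * L * (a - s)) * (a - s) * ?c * measure M A)
        + exp (2 * L * (b - s)) * (?\<Delta> * ?c * measure M A)"
    proof (rule add_mono)
      have "0 \<le> (LINT \<omega>:A|M. D (step k \<omega>))"
        unfolding set_lebesgue_integral_def by (intro integral_nonneg_AE AE_I2) (simp add: D_def)
      then show "(1 + 2 * L * ?\<Delta>) * (LINT \<omega>:A|M. D (step k \<omega>)) \<le>
          exp (2 * L * ?\<Delta>) * (exp (2 * L * (a - s)) * (a - s) * ?c * measure M A)"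
        using bspec[OF IH A] by (intro mult_mono exp_ge_add_one_self) (auto simp: a_def)
      have "1 \<le> exp (2 * L * (b - s))"
        using L_pos sa ab by (intro one_le_exp_iff[THEN iffD2] mult_nonneg_nonneg) auto
      moreover have "0 \<le> ?\<Delta> * ?c * measure M A"
        using c \<Delta> by (intro mult_nonneg_nonneg) auto
      ultimately show "?\<Delta> * ?c * measure M A \<le> exp (2 * L * (b - s)) * (?\<Delta> * ?c * measure M A)"
        using mult_right_mono[of 1 "exp (2 * L * (b - s))"] by fastforce
    qed
    also have "\<dots> = exp (2 * L * (b - s)) * (b - s) * ?c * measure M A"
    proof -
      have "exp (2 * L * ?\<Delta>) * exp (2 * L * (a - s)) = exp (2 * L * (b - s))"
        by (simp add: exp_add[symmetric] algebra_simps)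
      then have "exp (2 * L * ?\<Delta>) * (exp (2 * L * (a - s)) * (a - s) * ?c * measure M A) =
          exp (2 * L * (b - s)) * (a - s) * ?c * measure M A"
        by (simp only: mult.assoc[symmetric])
      then show ?thesis by (simp only:) (simp add: algebra_simps)
    qed
    finally show ?thesis .
  qed
  have "\<phi> b (w q) \<le> \<phi> s y" if "q \<in> G" for q
    using strategy(3)[OF that] G(5)[OF that] by (simp add: a_def)
  then have \<phi>_le: "\<phi> b (snd q) \<le> \<phi> s y" if "q \<in> ?G" for q
    using that by auto
  have G_sub: "?G \<subseteq> grid_simplex h \<times> prob_simplex"
    using strategy(2) by auto
  show ?case
    unfolding b_def[symmetric]
    by (intro exI[of _ ?G] conjI ballI allI) (fact finite G_sub range levels \<phi>_le estimate)+
qed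

text \<open>\<open>d\<close> is the final distance between state and guide. At the guide's end
  \<open>\<sigma>\<close> equals \<open>\<phi> T\<close>, which is at most
  \<open>\<phi> s y\<close>; the Lipschitz constant pays for \<open>d\<close>.\<close>

lemma guided_run_estimate:
  assumes S: "extremal_strategy T U V Q \<zeta> S" and \<zeta>: "solution_choice T U V Q \<phi> \<zeta>"
    and s: "s \<in> {0..T}" and y: "y \<in> grid_simplex h" and partition: "is_partition s T m t"
    and v: "\<forall>k\<le>m. v \<in> stoch_controls M F T U V Q h (t k)"
    and mesh: "\<forall>k<m. t (Suc k) - t k \<le> \<delta>"
    and modulus: "\<forall>\<delta>'\<le>\<delta>. drift_modulus \<delta>' \<epsilon>"
    and \<epsilon>: "8 * \<epsilon> + (3 * K\<^sup>2 + 8 * CARD('d) * K\<^sup>2 / h) * \<delta> \<le> \<eta>" and \<eta>: "0 \<le> \<eta>"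
    and P: "P \<in> cond_probs M (F s)"
    and \<sigma>: "\<forall>x\<in>prob_simplex. \<phi> T x = \<sigma> x" "R-lipschitz_on prob_simplex \<sigma>"
  obtains d :: "'w \<Rightarrow> real"
  where "(\<lambda>\<omega>. \<sigma> (guided_motion M F T Q h y S m t v T \<omega>)) \<in> borel_measurable P"
    "integrable P (\<lambda>\<omega>. \<sigma> (guided_motion M F T Q h y S m t v T \<omega>))"
    "integrable P (\<lambda>\<omega>. (d \<omega>)\<^sup>2)"
    "\<And>\<omega>. \<omega> \<in> space M \<Longrightarrow> \<sigma> (guided_motion M F T Q h y S m t v T \<omega>) \<le> \<phi> s y + R * d \<omega>"
    "(\<integral>\<omega>. (d \<omega>)\<^sup>2 \<partial>P) \<le> exp (2 * L * T) * T * (4 * CARD('d) * K * h + \<eta>)"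
proof -
  interpret P: prob_space P by (rule cond_probsD(1)[OF P])
  note [measurable_cong] = cond_probsD(2)[OF P]
  define Z where "Z = guided_step M F T Q h y S t v m"
  define D where "D = (\<lambda>q :: (real^'d) \<times> (real^'d). (norm (fst q - snd q))\<^sup>2)"
  let ?c = "4 * CARD('d) * K * h + \<eta>"
  have tm: "t m = T" by (rule is_partitionD(2)[OF partition])
  obtain G where G0: "finite G" "G \<subseteq> grid_simplex h \<times> prob_simplex" "\<forall>\<omega>\<in>space M. Z \<omega> \<in> G"
      "\<forall>q. {\<omega> \<in> space M. Z \<omega> = q} \<in> sets (F T)" "\<forall>q\<in>G. \<phi> T (snd q) \<le> \<phi> s y"
    and est: "\<forall>A\<in>sets (F s). (LINT \<omega>:A|M. D (Z \<omega>)) \<le>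
      exp (2 * L * (T - s)) * (T - s) * ?c * measure M A"
    using guided_step_estimate[OF S \<zeta> s y partition v mesh modulus \<epsilon> \<eta> order_refl]
    unfolding tm Z_def D_def by (elim exE conjE)
  note G = G0(1,2) G0(3)[rule_format] sets_F[OF G0(4)[rule_format]] G0(5)[rule_format]
  have meas: "(\<lambda>\<omega>. f (Z \<omega>)) \<in> borel_measurable M" for f :: "_ \<Rightarrow> real"
    by (rule finite_valued_measurable(1)[OF G(1,3,4)])
  have measP: "(\<lambda>\<omega>. f (Z \<omega>)) \<in> borel_measurable P" for f :: "_ \<Rightarrow> real"
    using meas[of f] by simp
  have int: "integrable P (\<lambda>\<omega>. f (Z \<omega>))" for f :: "_ \<Rightarrow> real"
    using finite_valued_measurable(2)[OF G(1,3,4), of _ f] cond_probsD(3)[OF P]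
    by (intro P.integrable_const_bound[OF _ measP] AE_I2) auto
  have final: "guided_motion M F T Q h y S m t v T \<omega> = fst (Z \<omega>)" for \<omega>
    unfolding Z_def by (rule guided_motion_final[OF partition])
  show ?thesis
  proof (rule that[of "\<lambda>\<omega>. norm (fst (Z \<omega>) - snd (Z \<omega>))"])
    show "(\<lambda>\<omega>. \<sigma> (guided_motion M F T Q h y S m t v T \<omega>)) \<in> borel_measurable P"
      unfolding final by (rule measP)
    show "integrable P (\<lambda>\<omega>. \<sigma> (guided_motion M F T Q h y S m t v T \<omega>))"
      unfolding final by (rule int)
    show "integrable P (\<lambda>\<omega>. (norm (fst (Z \<omega>) - snd (Z \<omega>)))\<^sup>2)"
      by (rule int)
    show "\<sigma> (guided_motion M F T Q h y S m t v T \<omega>) \<le> \<phi> s y + R * norm (fst (Z \<omega>) - snd (Z \<omega>))"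
      if "\<omega> \<in> space M" for \<omega>
    proof -
      have x: "fst (Z \<omega>) \<in> prob_simplex" and w: "snd (Z \<omega>) \<in> prob_simplex"
        using G(2) G(3)[OF that] by (auto simp: grid_simplex_def)
      have "\<bar>\<sigma> (fst (Z \<omega>)) - \<sigma> (snd (Z \<omega>))\<bar> \<le> R * norm (fst (Z \<omega>) - snd (Z \<omega>))"
        using lipschitz_on_normD[OF \<sigma>(2) x w] by simp
      then show ?thesis
        using G(5)[OF G(3)[OF that]] bspec[OF \<sigma>(1) w] unfolding final by linarith
    qed
    obtain A where A: "P = uniform_measure M A" "A \<in> sets (F s)" "0 < measure M A"
      using P by (auto simp: cond_probs_def)
    have "(\<integral>\<omega>. D (Z \<omega>) \<partial>P) = (LINT \<omega>:A|M. D (Z \<omega>)) / measure M A"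
      unfolding A(1) using integral_uniform_measure[OF finite_measure_axioms sets_F[OF A(2)] A(3) meas[of D]]
      by (simp add: divide_inverse mult.commute)
    also have "\<dots> \<le> exp (2 * L * (T - s)) * (T - s) * ?c"
      using bspec[OF est A(2)] A(3) by (simp add: pos_divide_le_eq)
    \<comment> \<open>Enlarging \<open>T - s\<close> to \<open>T\<close> makes the constant
      independent of the initial time.\<close>
    also have "\<dots> \<le> exp (2 * L * T) * T * ?c"
      using s L_pos K_pos h_pos \<eta> by (intro mult_right_mono mult_mono) auto
    finally show "(\<integral>\<omega>. (norm (fst (Z \<omega>) - snd (Z \<omega>)))\<^sup>2 \<partial>P) \<le> exp (2 * L * T) * T * ?c"
      by (simp add: D_def)
  qed
qed

text \<open>
  The free parameter \<open>r\<close> comes from \<open>d \<le> (d\<^sup>2 / r + r) / 2\<close> in the first bound; it is chosen as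
  \<open>sqrt \<kappa>\<close> there and as \<open>root 3 \<kappa>\<close> in the second one.
\<close>

lemma guided_run_bounds:
  assumes S: "extremal_strategy T U V Q \<zeta> S" and \<zeta>: "solution_choice T U V Q \<phi> \<zeta>"
    and s: "s \<in> {0..T}" and y: "y \<in> grid_simplex h" and T: "0 < T" and R: "0 < R"
    and \<sigma>: "\<forall>x\<in>prob_simplex. \<phi> T x = \<sigma> x" "R-lipschitz_on prob_simplex \<sigma>"
    and \<kappa>: "\<kappa> = exp (2 * L * T) * T * (4 * CARD('d) * K) * h" and e: "0 < e" and r: "0 < r"
  obtains \<delta> where "0 < \<delta>"
    "\<And>m t v P. is_partition s T m t \<Longrightarrow> mesh m t \<le> \<delta> \<Longrightarrow>
      \<forall>k\<le>m. v \<in> stoch_controls M F T U V Q h (t k) \<Longrightarrow> P \<in> cond_probs M (F s) \<Longrightarrow>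
      (\<integral>\<omega>. \<sigma> (guided_motion M F T Q h y S m t v T \<omega>) \<partial>P) \<le> \<phi> s y + R * ((\<kappa> + e) / r + r) / 2"
    "\<And>m t v P. is_partition s T m t \<Longrightarrow> mesh m t \<le> \<delta> \<Longrightarrow>
      \<forall>k\<le>m. v \<in> stoch_controls M F T U V Q h (t k) \<Longrightarrow> P \<in> cond_probs M (F s) \<Longrightarrow>
      measure P {\<omega> \<in> space M. \<phi> s y + R * r \<le> \<sigma> (guided_motion M F T Q h y S m t v T \<omega>)} \<le> (\<kappa> + e) / r\<^sup>2"
proof -
  \<comment> \<open>Scaled so that the error controlled by the mesh contributes exactly
    \<open>e\<close> after multiplication by the Gronwall factor.\<close>
  define \<eta> where "\<eta> = e / (exp (2 * L * T) * T)"
  have \<eta>: "0 < \<eta>" using e T by (simp add: \<eta>_def)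
  have \<kappa>e: "exp (2 * L * T) * T * (4 * CARD('d) * K * h + \<eta>) = \<kappa> + e"
    using T by (simp add: \<kappa> \<eta>_def distrib_left)
  let ?b = "3 * K\<^sup>2 + 8 * CARD('d) * K\<^sup>2 / h"
  have b: "0 < ?b" using K_pos h_pos by (intro add_pos_nonneg) auto
  obtain \<delta>\<^sub>0 where \<delta>0: "0 < \<delta>\<^sub>0" "\<And>\<delta>. \<delta> \<le> \<delta>\<^sub>0 \<Longrightarrow> drift_modulus \<delta> (\<eta> / 16)"
    using ex_drift_modulus[of "\<eta> / 16"] \<eta> by auto
  \<comment> \<open>The tolerance \<open>\<eta>\<close> is shared equally: the modulus of the drift
    takes \<open>8 * (\<eta> / 16)\<close>, and the second bound on \<open>\<delta>\<close> limits
    the term with \<open>?b\<close> to the other half.\<close>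
  define \<delta> where "\<delta> = min \<delta>\<^sub>0 (\<eta> / (2 * ?b))"
  have \<delta>: "0 < \<delta>" using \<delta>0 \<eta> b by (simp add: \<delta>_def)
  have "?b * \<delta> \<le> ?b * (\<eta> / (2 * ?b))"
    using b by (intro mult_left_mono) (auto simp: \<delta>_def)
  moreover have "c * (\<eta> / (2 * c)) = \<eta> / 2" if "0 < c" for c
    using that by simp
  ultimately have small: "8 * (\<eta> / 16) + ?b * \<delta> \<le> \<eta>"
    using b by fastforce
  have bounds: "(\<integral>\<omega>. \<sigma> (guided_motion M F T Q h y S m t v T \<omega>) \<partial>P) \<le> \<phi> s y + R * ((\<kappa> + e) / r + r) / 2 \<and>
      measure P {\<omega> \<in> space M. \<phi> s y + R * r \<le> \<sigma> (guided_motion M F T Q h y S m t v T \<omega>)} \<le> (\<kappa> + e) / r\<^sup>2"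
    if partition: "is_partition s T m t" and mesh: "mesh m t \<le> \<delta>"
      and v: "\<forall>k\<le>m. v \<in> stoch_controls M F T U V Q h (t k)" and P: "P \<in> cond_probs M (F s)"
    for m t v P
  proof -
    interpret P: prob_space P by (rule cond_probsD(1)[OF P])
    let ?Y = "\<lambda>\<omega>. \<sigma> (guided_motion M F T Q h y S m t v T \<omega>)"
    have mesh': "\<forall>k<m. t (Suc k) - t k \<le> \<delta>"
      using mesh \<delta> by (simp add: mesh_le_iff)
    have modulus: "\<forall>\<delta>'\<le>\<delta>. drift_modulus \<delta>' (\<eta> / 16)"
      by (intro allI impI \<delta>0(2)) (simp add: \<delta>_def)
    obtain d :: "'w \<Rightarrow> real" where Y: "?Y \<in> borel_measurable P" "integrable P ?Y"
      and d: "integrable P (\<lambda>\<omega>. (d \<omega>)\<^sup>2)"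
      and Y_le: "\<And>\<omega>. \<omega> \<in> space M \<Longrightarrow> ?Y \<omega> \<le> \<phi> s y + R * d \<omega>"
      and "(\<integral>\<omega>. (d \<omega>)\<^sup>2 \<partial>P) \<le> exp (2 * L * T) * T * (4 * CARD('d) * K * h + \<eta>)"
      by (rule guided_run_estimate[OF S \<zeta> s y partition v mesh' modulus small less_imp_le[OF \<eta>] P \<sigma>])
        (rule that)
    then have d_le: "(\<integral>\<omega>. (d \<omega>)\<^sup>2 \<partial>P) \<le> \<kappa> + e"
      unfolding \<kappa>e by simp
    have "(\<integral>\<omega>. ?Y \<omega> \<partial>P) \<le> (\<integral>\<omega>. \<phi> s y + R * ((d \<omega>)\<^sup>2 / r + r) / 2 \<partial>P)"
    proof (rule integral_mono[OF Y(2)])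
      show "integrable P (\<lambda>\<omega>. \<phi> s y + R * ((d \<omega>)\<^sup>2 / r + r) / 2)"
        using d by (intro Bochner_Integration.integrable_add integrable_mult_right
            integrable_divide P.integrable_const) auto
      fix \<omega> assume "\<omega> \<in> space P"
      then have "?Y \<omega> \<le> \<phi> s y + R * d \<omega>"
        using Y_le cond_probsD(3)[OF P] by simp
      also have "d \<omega> \<le> ((d \<omega>)\<^sup>2 / r + r) / 2"
        using zero_le_power2[of "d \<omega> - r"] r by (simp add: field_simps power2_eq_square)
      finally show "?Y \<omega> \<le> \<phi> s y + R * ((d \<omega>)\<^sup>2 / r + r) / 2"
        using R by simp
    qed
    also have "\<dots> = \<phi> s y + R * ((\<integral>\<omega>. (d \<omega>)\<^sup>2 \<partial>P) / r + r) / 2"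
      using d by (simp add: P.prob_space)
    also have "\<dots> \<le> \<phi> s y + R * ((\<kappa> + e) / r + r) / 2"
      using d_le R r by (intro add_left_mono divide_right_mono mult_left_mono add_right_mono) auto
    finally have 1: "(\<integral>\<omega>. ?Y \<omega> \<partial>P) \<le> \<phi> s y + R * ((\<kappa> + e) / r + r) / 2" .
    let ?A = "{\<omega> \<in> space M. \<phi> s y + R * r \<le> ?Y \<omega>}"
    have "?A = {\<omega> \<in> space P. \<phi> s y + R * r \<le> ?Y \<omega>}"
      using cond_probsD(3)[OF P] by simp
    then have A: "?A \<in> sets P" using Y(1) by simp
    then have "measure P ?A = (\<integral>\<omega>. indicator ?A \<omega> \<partial>P)" by simp
    also have "\<dots> \<le> (\<integral>\<omega>. (d \<omega>)\<^sup>2 / r\<^sup>2 \<partial>P)"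
    proof (rule integral_mono)
      show "integrable P (indicator ?A :: 'w \<Rightarrow> real)"
        using A by (intro integrable_real_indicator) (auto simp: P.emeasure_eq_measure)
      fix \<omega>
      have "1 \<le> (d \<omega>)\<^sup>2 / r\<^sup>2" if \<omega>: "\<omega> \<in> ?A"
      proof -
        have "R * r \<le> R * d \<omega>" using Y_le[of \<omega>] \<omega> by simp
        then have "r \<le> d \<omega>" using R by simp
        then have "r\<^sup>2 \<le> (d \<omega>)\<^sup>2" using r by (intro power_mono) auto
        then show ?thesis using r by simp
      qed
      then show "indicator ?A \<omega> \<le> (d \<omega>)\<^sup>2 / r\<^sup>2"
        by (auto split: split_indicator)
    qed (use d in simp)
    also have "\<dots> = (\<integral>\<omega>. (d \<omega>)\<^sup>2 \<partial>P) / r\<^sup>2" by simp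
    also have "\<dots> \<le> (\<kappa> + e) / r\<^sup>2"
      using d_le by (intro divide_right_mono) auto
    finally show ?thesis
      using 1 by simp
  qed
  show ?thesis
    by (rule that[OF \<delta> conjunct1[OF bounds] conjunct2[OF bounds]])
qed

end

subsection \<open>The limit as the mesh tends to 0\<close>

text \<open>Monotonicity turns the right-hand limit at 0 into the infimum over positive
  \<open>\<delta>\<close>. In \<open>ereal\<close> this infimum, and the suprema to which the lemma
  is applied, always exist.\<close>

lemma right_limit_le:
  fixes g :: "real \<Rightarrow> ereal"
  assumes mono: "\<And>\<delta> \<delta>'. 0 < \<delta> \<Longrightarrow> \<delta> \<le> \<delta>' \<Longrightarrow> g \<delta> \<le> g \<delta>'"
    and le: "\<And>e. 0 < e \<Longrightarrow> \<exists>\<delta>>0. g \<delta> \<le> ereal (c + e)"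
  shows "\<exists>l. (g \<longlongrightarrow> l) (at_right 0) \<and> l \<le> ereal c"
proof (intro exI conjI)
  let ?l = "INF \<delta>\<in>{0<..}. g \<delta>"
  show "(g \<longlongrightarrow> ?l) (at_right 0)"
  proof (rule order_tendstoI)
    fix x assume "x < ?l"
    then have "\<forall>\<delta>>0. x < g \<delta>"
      using INF_lower[of _ "{0<..}" g] by (auto intro: less_le_trans)
    then show "\<forall>\<^sub>F \<delta> in at_right 0. x < g \<delta>"
      by (auto simp: eventually_at_filter)
  next
    fix x assume "?l < x"
    then obtain \<delta>\<^sub>0 where "0 < \<delta>\<^sub>0" "g \<delta>\<^sub>0 < x" by (auto simp: INF_less_iff)
    then show "\<forall>\<^sub>F \<delta> in at_right 0. g \<delta> < x"
      using mono[of _ \<delta>\<^sub>0] unfolding eventually_at_right_field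
      by (meson le_less_trans less_imp_le)
  qed
  show "?l \<le> ereal c"
  proof (rule ereal_le_epsilon2)
    fix e :: real assume "0 < e"
    then obtain \<delta> where "0 < \<delta>" "g \<delta> \<le> ereal (c + e)" using le by blast
    then show "?l \<le> ereal c + ereal e"
      by (intro INF_lower2[of \<delta>]) auto
  qed
qed

text \<open>\<open>D\<close> is chosen before the probability space, \<open>n\<close>,
  \<open>\<sigma>\<close> and \<open>\<phi>\<close>. Conditioning on the history at \<open>s\<close>
  is represented by all \<open>P\<close> in \<open>cond_probs M (F s)\<close>, over which the
  suprema run as well; \<open>v\<close> has to be a stochastic control from each partition point on,
  since the motion is restarted there. Existence of the limits is part of the claim.\<close>

theorem theorem1:
  fixes T :: real
    and U :: "'u::{metric_space, second_countable_topology} set"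
    and V :: "'v::{metric_space, second_countable_topology} set"
    and Q :: "('u, 'v, 'd::finite) rate_matrix"
  assumes "0 < T"
    and "compact U" "U \<noteq> {}"
    and "compact V" "V \<noteq> {}"
    and "\<And>t x u v. t \<in> {0..T} \<Longrightarrow> x \<in> prob_simplex \<Longrightarrow> u \<in> U \<Longrightarrow> v \<in> V \<Longrightarrow> kolmogorov (Q t x u v)"
    and "continuous_on ({0..T} \<times> prob_simplex \<times> U \<times> V) (\<lambda>(t, x, u, v). Q t x u v)"
    and "\<exists>K. \<forall>t\<in>{0..T}. \<forall>u\<in>U. \<forall>v\<in>V. K-lipschitz_on prob_simplex (\<lambda>x. Q t x u v)"
    and "\<And>t x \<xi>. t \<in> {0..T} \<Longrightarrow> x \<in> prob_simplex \<Longrightarrow>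
           minmax U V (\<lambda>u v. \<xi> \<bullet> (x v* Q t x u v)) = maxmin U V (\<lambda>u v. \<xi> \<bullet> (x v* Q t x u v))"
  shows "\<exists>D>0. \<forall>(M :: 'w measure) F n s y \<sigma> R \<phi> \<zeta> S.
    prob_space M \<longrightarrow> filtration (space M) F \<longrightarrow> (\<forall>t. subalgebra M (F t)) \<longrightarrow>
    (0::nat) < n \<longrightarrow> s \<in> {0..T} \<longrightarrow> y \<in> grid_simplex (1 / real n) \<longrightarrow>
    0 < R \<longrightarrow> R-lipschitz_on prob_simplex \<sigma> \<longrightarrow>
    supersolution T U V Q \<sigma> \<phi> \<longrightarrow> solution_choice T U V Q \<phi> \<zeta> \<longrightarrow> extremal_strategy T U V Q \<zeta> S \<longrightarrow>
    (let h = 1 / real n;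
         runs = (\<lambda>\<delta>. {(m, t, v, P). is_partition s T m t \<and> mesh m t \<le> \<delta> \<and>
                   (\<forall>k\<le>m. v \<in> stoch_controls M F T U V Q h (t k)) \<and> P \<in> cond_probs M (F s)});
         X = (\<lambda>m t v. guided_motion M F T Q h y S m t v T)
     in (\<exists>l. ((\<lambda>\<delta>. SUP (m, t, v, P)\<in>runs \<delta>. ereal (\<integral>\<omega>. \<sigma> (X m t v \<omega>) \<partial>P)) \<longlongrightarrow> l) (at_right 0) \<and>
             l \<le> ereal (\<phi> s y + R * sqrt (D * h))) \<and>
        (\<exists>l. ((\<lambda>\<delta>. SUP (m, t, v, P)\<in>runs \<delta>.
                ereal (measure P {\<omega> \<in> space M. \<phi> s y + R * root 3 (D * h) \<le> \<sigma> (X m t v \<omega>)})) \<longlongrightarrow> l)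
              (at_right 0) \<and>
             l \<le> ereal (root 3 (D * h))))"
proof -
  let ?C = "{0..T} \<times> (prob_simplex :: (real^'d) set) \<times> U \<times> V"
  have "compact ?C"
    using assms(2,4) by (intro compact_Times compact_Icc compact_prob_simplex)
  with assms(7) have "bounded ((\<lambda>(t, x, u, v). Q t x u v) ` ?C)"
    by (intro compact_imp_bounded compact_continuous_image)
  then obtain K\<^sub>1 where K1: "\<And>p. p \<in> ?C \<Longrightarrow> norm ((\<lambda>(t, x, u, v). Q t x u v) p) \<le> K\<^sub>1"
    unfolding bounded_iff by blast
  obtain K\<^sub>2 where K2: "\<forall>t\<in>{0..T}. \<forall>u\<in>U. \<forall>v\<in>V. K\<^sub>2-lipschitz_on prob_simplex (\<lambda>x. Q t x u v)"
    using assms(8) by blast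
  \<comment> \<open>The 1 in the maximum makes \<open>K\<close> positive.\<close>
  define K where "K = max 1 (max K\<^sub>1 K\<^sub>2)"
  interpret G: markov_game T U V Q K
  proof
    show "norm (Q t x u v) \<le> K" if "t \<in> {0..T}" "x \<in> prob_simplex" "u \<in> U" "v \<in> V" for t x u v
      using K1[of "(t, x, u, v)"] that by (simp add: K_def)
    show "K-lipschitz_on prob_simplex (\<lambda>x. Q t x u v)" if "t \<in> {0..T}" "u \<in> U" "v \<in> V" for t u v
      by (rule lipschitz_on_mono[OF K2[rule_format, OF that]]) (simp_all add: K_def)
    show "0 < K" by (simp add: K_def)
  qed (fact assms)+
  \<comment> \<open>The Gronwall factor times the coefficient of \<open>h\<close> in the one-step
    error, so that \<open>D * h\<close> is the \<open>\<kappa>\<close> of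
    \<open>guided_run_bounds\<close>.\<close>
  define D where "D = exp (2 * G.L * T) * T * (4 * CARD('d) * K)"
  show ?thesis
  proof (intro exI[of _ D] conjI allI impI)
    show "0 < D" using assms(1) G.K_pos by (simp add: D_def)
    fix M :: "'w measure" and F :: "real \<Rightarrow> 'w measure" and n s and y :: "real^'d" and R
      and \<sigma> :: "real^'d \<Rightarrow> real" and \<phi> \<zeta> and S :: "('u, 'd) guide_strategy"
    assume M: "prob_space M" and F: "filtration (space M) F" "\<forall>t. subalgebra M (F t)"
      and n: "(0::nat) < n" and s: "s \<in> {0..T}" and y: "y \<in> grid_simplex (1 / real n)"
      and R: "0 < R" "R-lipschitz_on prob_simplex \<sigma>" and super: "supersolution T U V Q \<sigma> \<phi>"
      and \<zeta>: "solution_choice T U V Q \<phi> \<zeta>" and S: "extremal_strategy T U V Q \<zeta> S"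
    interpret M: prob_space M by (rule M)
    interpret R: game_run T U V Q K M F "1 / real n"
      using n by (intro game_run.intro game_run_axioms.intro G.markov_game_axioms M F(1) F(2)[rule_format]) simp
    let ?h = "1 / real n"
    let ?runs = "\<lambda>\<delta>. {(m, t, v, P). is_partition s T m t \<and> mesh m t \<le> \<delta> \<and>
                   (\<forall>k\<le>m. v \<in> stoch_controls M F T U V Q ?h (t k)) \<and> P \<in> cond_probs M (F s)}"
    let ?X = "\<lambda>m t v. guided_motion M F T Q ?h y S m t v T"
    have \<sigma>: "\<forall>x\<in>prob_simplex. \<phi> T x = \<sigma> x"
      using super by (simp add: supersolution_def)
    have Dh: "0 < D * ?h" using \<open>0 < D\<close> n by simp
    note bounds = R.guided_run_bounds[OF S \<zeta> s y assms(1) R(1) \<sigma> R(2), of "D * ?h"]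
    have \<kappa>: "D * ?h = exp (2 * G.L * T) * T * (4 * CARD('d) * K) * ?h"
      by (simp add: D_def)
    have runs_mono: "?runs \<delta> \<subseteq> ?runs \<delta>'" if "\<delta> \<le> \<delta>'" for \<delta> \<delta>'
      using that by auto
    have "\<exists>l. ((\<lambda>\<delta>. SUP (m, t, v, P)\<in>?runs \<delta>. ereal (\<integral>\<omega>. \<sigma> (?X m t v \<omega>) \<partial>P)) \<longlongrightarrow> l) (at_right 0) \<and>
        l \<le> ereal (\<phi> s y + R * sqrt (D * ?h))"
    proof (rule right_limit_le)
      fix \<delta> \<delta>' :: real assume "\<delta> \<le> \<delta>'"
      then show "(SUP (m, t, v, P)\<in>?runs \<delta>. ereal (\<integral>\<omega>. \<sigma> (?X m t v \<omega>) \<partial>P)) \<le>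
          (SUP (m, t, v, P)\<in>?runs \<delta>'. ereal (\<integral>\<omega>. \<sigma> (?X m t v \<omega>) \<partial>P))"
        by (intro SUP_subset_mono runs_mono order_refl)
    next
      fix e :: real assume e: "0 < e"
      define r where "r = sqrt (D * ?h)"
      have r: "0 < r" "D * ?h = r\<^sup>2" using Dh by (simp_all add: r_def)
      \<comment> \<open>This slack becomes exactly \<open>e\<close> after division by
        \<open>r\<close>, multiplication by \<open>R\<close> and halving; the rest is
        \<open>R * r\<close> because \<open>D * ?h\<close> equals \<open>r\<^sup>2\<close>.\<close>
      have e': "0 < 2 * r * e / R" using e r R by simp
      have eq: "R * ((D * ?h + 2 * r * e / R) / r + r) / 2 = R * r + e"
        unfolding r(2) using r(1) R(1) by (simp add: field_simps power2_eq_square)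
      obtain \<delta> where "0 < \<delta>" and \<delta>: "\<And>m t v P. is_partition s T m t \<Longrightarrow> mesh m t \<le> \<delta> \<Longrightarrow>
          \<forall>k\<le>m. v \<in> stoch_controls M F T U V Q ?h (t k) \<Longrightarrow> P \<in> cond_probs M (F s) \<Longrightarrow>
          (\<integral>\<omega>. \<sigma> (?X m t v \<omega>) \<partial>P) \<le> \<phi> s y + R * ((D * ?h + 2 * r * e / R) / r + r) / 2"
        by (rule bounds[OF \<kappa> e' r(1)]) (rule that)
      then have "(SUP (m, t, v, P)\<in>?runs \<delta>. ereal (\<integral>\<omega>. \<sigma> (?X m t v \<omega>) \<partial>P)) \<le>
          ereal (\<phi> s y + R * sqrt (D * ?h) + e)"
        unfolding eq r_def[symmetric] by (intro SUP_least) (auto simp: add.assoc)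
      then show "\<exists>\<delta>>0. (SUP (m, t, v, P)\<in>?runs \<delta>. ereal (\<integral>\<omega>. \<sigma> (?X m t v \<omega>) \<partial>P)) \<le>
          ereal (\<phi> s y + R * sqrt (D * ?h) + e)"
        using \<open>0 < \<delta>\<close> by blast
    qed
    moreover have "\<exists>l. ((\<lambda>\<delta>. SUP (m, t, v, P)\<in>?runs \<delta>.
          ereal (measure P {\<omega> \<in> space M. \<phi> s y + R * root 3 (D * ?h) \<le> \<sigma> (?X m t v \<omega>)})) \<longlongrightarrow> l)
        (at_right 0) \<and> l \<le> ereal (root 3 (D * ?h))"
    proof (rule right_limit_le)
      fix \<delta> \<delta>' :: real assume "\<delta> \<le> \<delta>'"
      then show "(SUP (m, t, v, P)\<in>?runs \<delta>.
            ereal (measure P {\<omega> \<in> space M. \<phi> s y + R * root 3 (D * ?h) \<le> \<sigma> (?X m t v \<omega>)})) \<le>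
          (SUP (m, t, v, P)\<in>?runs \<delta>'.
            ereal (measure P {\<omega> \<in> space M. \<phi> s y + R * root 3 (D * ?h) \<le> \<sigma> (?X m t v \<omega>)}))"
        by (intro SUP_subset_mono runs_mono order_refl)
    next
      fix e :: real assume e: "0 < e"
      define r where "r = root 3 (D * ?h)"
      have r: "0 < r" "D * ?h = r ^ 3" using Dh by (simp_all add: r_def)
      \<comment> \<open>With the cube root, \<open>D * ?h / r\<^sup>2\<close> is \<open>r\<close>
        again, so threshold and probability balance; the slack becomes exactly \<open>e\<close>
        after division by \<open>r\<^sup>2\<close>.\<close>
      have e': "0 < r\<^sup>2 * e" using e r by simp
      have eq: "(D * ?h + r\<^sup>2 * e) / r\<^sup>2 = r + e"
        unfolding r(2) using r(1) by (simp add: add_divide_distrib power3_eq_cube power2_eq_square)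
      obtain \<delta> where "0 < \<delta>" and \<delta>: "\<And>m t v P. is_partition s T m t \<Longrightarrow> mesh m t \<le> \<delta> \<Longrightarrow>
          \<forall>k\<le>m. v \<in> stoch_controls M F T U V Q ?h (t k) \<Longrightarrow> P \<in> cond_probs M (F s) \<Longrightarrow>
          measure P {\<omega> \<in> space M. \<phi> s y + R * r \<le> \<sigma> (?X m t v \<omega>)} \<le> (D * ?h + r\<^sup>2 * e) / r\<^sup>2"
        by (rule bounds[OF \<kappa> e' r(1)]) (rule that)
      then have "(SUP (m, t, v, P)\<in>?runs \<delta>.
          ereal (measure P {\<omega> \<in> space M. \<phi> s y + R * root 3 (D * ?h) \<le> \<sigma> (?X m t v \<omega>)})) \<le>
          ereal (root 3 (D * ?h) + e)"
        unfolding eq r_def[symmetric] by (intro SUP_least) auto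
      then show "\<exists>\<delta>>0. (SUP (m, t, v, P)\<in>?runs \<delta>.
          ereal (measure P {\<omega> \<in> space M. \<phi> s y + R * root 3 (D * ?h) \<le> \<sigma> (?X m t v \<omega>)})) \<le>
          ereal (root 3 (D * ?h) + e)"
        using \<open>0 < \<delta>\<close> by blast
    qed
    ultimately show "let h = 1 / real n;
         runs = (\<lambda>\<delta>. {(m, t, v, P). is_partition s T m t \<and> mesh m t \<le> \<delta> \<and>
                   (\<forall>k\<le>m. v \<in> stoch_controls M F T U V Q h (t k)) \<and> P \<in> cond_probs M (F s)});
         X = (\<lambda>m t v. guided_motion M F T Q h y S m t v T)
     in (\<exists>l. ((\<lambda>\<delta>. SUP (m, t, v, P)\<in>runs \<delta>. ereal (\<integral>\<omega>. \<sigma> (X m t v \<omega>) \<partial>P)) \<longlongrightarrow> l) (at_right 0) \<and>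
             l \<le> ereal (\<phi> s y + R * sqrt (D * h))) \<and>
        (\<exists>l. ((\<lambda>\<delta>. SUP (m, t, v, P)\<in>runs \<delta>.
                ereal (measure P {\<omega> \<in> space M. \<phi> s y + R * root 3 (D * h) \<le> \<sigma> (X m t v \<omega>)})) \<longlongrightarrow> l)
              (at_right 0) \<and>
             l \<le> ereal (root 3 (D * h)))"
      unfolding Let_def by (rule conjI)
  qed
qed

end
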